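(* Let $L>0$, $p>1$, and let $a\in\mathcal{C}([0,L])$ satisfy the following two conditions. (1) For some integer $n\geq 1$ there are points $0=\tau_{0}\leq\sigma_{1}<\tau_{1}<\sigma_{2}<\tau_{2}<\cdots<\sigma_{n}<\tau_{n}\leq\sigma_{n+1}=L$ such that $a(x)>0$ for all $x\in I_i^+:=(\sigma_i,\tau_i)$, $i=1,\dots,n$, and $a(x)<0$ for all $x\in I_i^-:=(\tau_i,\sigma_{i+1})$, $i=0,\dots,n$. (2) For every $i\in\{1,\dots,n\}$ there exist a constant $\gamma_i>0$ and a continuous function $\rho_i:[\sigma_i,\tau_i]\to\mathbb{R}$, bounded away from zero in a neighborhood of $\partial I_i^+=\{\sigma_i,\tau_i\}$, such that $a(x)=\rho_i(x)\,[\mathrm{dist}(x,\partial I_i^+)]^{\gamma_i}$ for all $x\in I_i^+$. Then there exists $\lambda_c=\lambda_c(a)<0$ such that, for every $\lambda<\lambda_c$, the boundary value problem $$-u''=\lambda u+a(x)u^{p}\ \text{ in } (0,L),\qquad u(0)=u(L)=0,$$ possesses at least $2^{n}-1$ positive solutions.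
   Context: A positive solution is a function $u\in\mathcal{C}^2([0,L])$ with $u\geq 0$ in $[0,L]$ and $u\not\equiv 0$ that solves the boundary value problem. The intervals $I_0^-$ and $I_n^-$ may be empty (when $\sigma_1=0$, respectively $\tau_n=L$). *)

theory Defs
  imports "HOL-Analysis.Analysis"
begin

text \<open>Twice continuous differentiability on a closed interval: the derivatives at the
  end points are one-sided, and the second derivative is continuous up to the boundary.\<close>

definition C2_on :: "real set \<Rightarrow> (real \<Rightarrow> real) \<Rightarrow> bool" where
  "C2_on S u \<longleftrightarrow>
     (\<exists>u' u''. (\<forall>x\<in>S. (u has_real_derivative u' x) (at x within S)) \<and>
               (\<forall>x\<in>S. (u' has_real_derivative u'' x) (at x within S)) \<and>
               continuous_on S u'')"

text \<open>Only the values of \<open>u\<close> on \<open>[0, L]\<close> matter: the equation is imposed at interior points,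
  where the two-sided \<^const>\<open>deriv\<close> agrees with the derivatives of \<^const>\<open>C2_on\<close>.
  Since \<open>0 powr p = 0\<close>, the term \<open>u x powr p\<close> is the usual power for \<open>u x \<ge> 0\<close> and \<open>p > 0\<close>.\<close>

definition positive_solution ::
    "real \<Rightarrow> real \<Rightarrow> (real \<Rightarrow> real) \<Rightarrow> real \<Rightarrow> (real \<Rightarrow> real) \<Rightarrow> bool" where
  "positive_solution L p a lam u \<longleftrightarrow>
     C2_on {0..L} u \<and>
     (\<forall>x\<in>{0..L}. 0 \<le> u x) \<and>
     (\<exists>x\<in>{0..L}. u x \<noteq> 0) \<and>
     (\<forall>x\<in>{0<..<L}. - deriv (deriv u) x = lam * u x + a x * u x powr p) \<and>
     u 0 = 0 \<and> u L = 0"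

end

theory Submission
  imports Defs
begin

text \<open>
The proof is a shooting argument. Put \<open>\<mu> = - lam\<close> and let \<open>U s\<close> be the solution of
\<open>u'' = \<mu> u - a u\<^sup>p\<close> with \<open>u 0 = 0\<close> and \<open>u' 0 = s\<close>, continued linearly once it becomes negative
and with the power made linear above a height \<open>R\<close>, so that all solutions exist on \<open>[0, L]\<close> and depend
continuously on \<open>s\<close> (\<open>shooting_family\<close>). A solution that becomes negative remains negative
(\<open>negative_stays_negative\<close>). Hence each \<open>s > 0\<close> with \<open>U s L = 0\<close> gives a positive solution,
provided that it stays below \<open>R\<close>, and distinct slopes give distinct solutions. So it is enough to find
\<open>2\<^sup>n - 1\<close> positive zeros of \<open>s \<mapsto> U s L\<close>.

Call \<open>[\<sigma> i, \<tau> i]\<close> a well and \<open>[\<tau> i, \<sigma> (i + 1)]\<close> a gap. Three facts drive the argument.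

\<^item> Confinement (\<open>nonneg_bound\<close>): for given \<open>\<mu>\<close> and large \<open>R\<close>, a solution that is nonnegative on
  a well is below \<open>R\<close> there. Since \<open>u'' \<le> \<mu> u\<close> in a well, a solution that is very high at one point
  is still high on a fixed inner window, and there it would oscillate too fast to remain positive.

\<^item> Growth (\<open>growth_threshold_two_sided\<close>): there is a height \<open>C\<close>, depending on \<open>a\<close> and \<open>p\<close> only,
  such that a solution entering an inner gap, from either side, at height \<open>C\<close> or more and without
  descending exceeds any prescribed \<open>R\<close> at the other side. This is the blow-up of
  \<open>u'' \<ge> m u\<^sup>p\<close> in finite time.

\<^item> Convexity: in a gap every solution is convex. If \<open>\<mu> \<ge> max \<bar>a\<bar> * C powr (p - 1)\<close>, then
  solutions are convex everywhere as long as they are below \<open>C\<close>. This is where \<open>lam\<close> has to be very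
  negative, and the condition makes sense because \<open>C\<close> does not depend on \<open>\<mu>\<close>.

Call a slope low for the well \<open>i\<close> if it is \<open>0\<close> or the solution is negative at \<open>\<sigma> i\<close>, and high if the
solution reaches \<open>C\<close> in the well but is negative at \<open>\<tau> i\<close>. Between a low and a high slope there is a
slope \<open>m\<close> for which the maximum over the well is exactly \<open>C\<close> (\<open>turning_slope\<close>). By convexity this
maximum sits at an end of the well. The left end is impossible, because the solution would descend through
the gap before it: by growth from right to left it would exceed \<open>R\<close> in the preceding well, against
confinement, and before the first well it would descend from \<open>U m 0 = 0\<close> to \<open>C > 0\<close>. Thus \<open>U m\<close> leaves the well upwards at height \<open>C\<close>, enters the next well above \<open>R\<close> by growth,
and becomes negative there by confinement: \<open>m\<close> is high for the next well. The two slopes between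
which \<open>m\<close> was found are both low for the next well. Therefore every well doubles the
number of disjoint intervals between a low and a high slope (\<open>many_zeros_between\<close>). After the last
well there are \<open>2\<^sup>n\<close> intervals across which \<open>U s L\<close> changes sign; one of them has the trivial
slope \<open>0\<close> as an end point and is the only one that may fail to contribute.
\<close>

section \<open>Convexity, blow-up and comparison on an interval\<close>

definition second_deriv_on ::
    "real set \<Rightarrow> (real \<Rightarrow> real) \<Rightarrow> (real \<Rightarrow> real) \<Rightarrow> (real \<Rightarrow> real) \<Rightarrow> bool" where
  "second_deriv_on S f f' f'' \<longleftrightarrow>
     (\<forall>x\<in>S. (f has_real_derivative f' x) (at x within S)) \<and>
     (\<forall>x\<in>S. (f' has_real_derivative f'' x) (at x within S))"

lemma second_deriv_on_subset:
  assumes "second_deriv_on S f f' f''" "T \<subseteq> S"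
  shows "second_deriv_on T f f' f''"
  using assms unfolding second_deriv_on_def by (meson DERIV_subset subsetD)

lemma second_deriv_on_continuous:
  assumes "second_deriv_on S f f' f''"
  shows "continuous_on S f"
  using assms unfolding second_deriv_on_def by (intro DERIV_continuous_on[of S f f']) auto

lemma second_deriv_on_diff:
  assumes "second_deriv_on S f f' f''" "second_deriv_on S g g' g''"
  shows "second_deriv_on S (\<lambda>x. f x - g x) (\<lambda>x. f' x - g' x) (\<lambda>x. f'' x - g'' x)"
  using assms unfolding second_deriv_on_def by (auto intro: DERIV_diff)

lemma second_deriv_on_reflect:
  assumes "second_deriv_on {b..c} f f' f''"
  shows "second_deriv_on {-c..-b} (\<lambda>x. f (-x)) (\<lambda>x. - f' (-x)) (\<lambda>x. f'' (-x))"
proof -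
  have im: "uminus ` {-c..-b} = {b..c}" by simp
  have chain: "((\<lambda>x. g (-x)) has_real_derivative - g' (-x)) (at x within {-c..-b})"
    if "(g has_real_derivative g' (-x)) (at (-x) within {b..c})" for g g' :: "real \<Rightarrow> real" and x
  proof -
    have "(uminus has_real_derivative -1) (at x within {-c..-b})"
      by (auto intro!: derivative_eq_intros)
    from DERIV_image_chain[OF _ this, of g "g' (-x)"] that show ?thesis
      unfolding im by (simp add: o_def)
  qed
  show ?thesis
    using assms unfolding second_deriv_on_def
    by (auto intro!: chain DERIV_minus[THEN DERIV_cong] )
qed

lemma deriv_le_imp_increment_le:
  fixes f g :: "real \<Rightarrow> real"
  assumes "\<And>x. x \<in> {b..c} \<Longrightarrow> (f has_real_derivative f' x) (at x within {b..c})"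
    and "\<And>x. x \<in> {b..c} \<Longrightarrow> (g has_real_derivative g' x) (at x within {b..c})"
    and "\<And>x. x \<in> {b<..<c} \<Longrightarrow> f' x \<le> g' x"
    and "b \<le> c"
  shows "f c - f b \<le> g c - g b"
proof (cases "b = c")
  case False
  with assms(4) have "b < c" by simp
  have "\<exists>x\<in>{b<..<c}. (\<lambda>x. g x - f x) c - (\<lambda>x. g x - f x) b = (\<lambda>h. h * (g' x - f' x)) (c - b)"
    by (rule mvt_simple[OF \<open>b < c\<close>])
      (use DERIV_diff[OF assms(2,1)] in \<open>auto simp: has_field_derivative_def mult.commute[of _ "_ - _"]\<close>)
  then obtain x where "x \<in> {b<..<c}" "g c - f c - (g b - f b) = (c - b) * (g' x - f' x)" by auto
  with assms(3)[of x] \<open>b < c\<close> have "0 \<le> g c - f c - (g b - f b)" by simp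
  then show ?thesis by simp
qed simp

lemma second_deriv_lower_bound:
  assumes "second_deriv_on {b..c} f f' f''" "\<And>x. x \<in> {b<..<c} \<Longrightarrow> m \<le> f'' x" "b \<le> c"
  shows deriv_lower_bound: "f' b + m * (c - b) \<le> f' c"
    and quadratic_lower_bound: "f b + f' b * (c - b) + m * (c - b)\<^sup>2 / 2 \<le> f c"
proof -
  have slope: "f' b + m * (x - b) \<le> f' x" if "x \<in> {b..c}" for x
  proof -
    have "(\<lambda>x. m * x) x - (\<lambda>x. m * x) b \<le> f' x - f' b"
      by (rule deriv_le_imp_increment_le[where f'="\<lambda>_. m" and g'=f''])
        (use second_deriv_on_subset[OF assms(1), of "{b..x}"] assms(2) that
          in \<open>auto simp: second_deriv_on_def intro!: derivative_eq_intros\<close>)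
    then show ?thesis by (simp add: algebra_simps)
  qed
  then show "f' b + m * (c - b) \<le> f' c" using assms(3) by simp
  have "(\<lambda>x. f' b * (x - b) + m * (x - b)\<^sup>2 / 2) c - (\<lambda>x. f' b * (x - b) + m * (x - b)\<^sup>2 / 2) b
     \<le> f c - f b"
    by (rule deriv_le_imp_increment_le[where f'="\<lambda>x. f' b + m * (x - b)" and g'=f'])
      (use assms slope in \<open>auto simp: second_deriv_on_def power2_eq_square intro!: derivative_eq_intros\<close>)
  then show "f b + f' b * (c - b) + m * (c - b)\<^sup>2 / 2 \<le> f c" by simp
qed

lemma tangent_below:
  assumes "second_deriv_on {b..c} f f' f''" "\<And>x. x \<in> {b<..<c} \<Longrightarrow> 0 \<le> f'' x"
    and "x \<in> {b..c}" "y \<in> {b..c}"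
  shows "f x + f' x * (y - x) \<le> f y"
proof (cases "x \<le> y")
  case True
  then show ?thesis
    using quadratic_lower_bound[of x y f f' f'' 0] assms
      second_deriv_on_subset[OF assms(1), of "{x..y}"] by auto
next
  case False
  have "f (-(-x)) + - f' (-(-x)) * (- y - - x) + 0 * (- y - - x)\<^sup>2 / 2 \<le> f (-(-y))"
    by (rule quadratic_lower_bound[OF second_deriv_on_subset
          [OF second_deriv_on_reflect[OF assms(1)]]])
      (use assms False in auto)
  then show ?thesis by (simp add: algebra_simps)
qed

lemma slope_mono:
  assumes "second_deriv_on {b..c} f f' f''" "\<And>x. x \<in> {b<..<c} \<Longrightarrow> 0 \<le> f'' x"
    and "b \<le> x" "x \<le> y" "y \<le> c"
  shows "f' x \<le> f' y"
  using deriv_lower_bound[of x y f f' f'' 0] assms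
    second_deriv_on_subset[OF assms(1), of "{x..y}"] by auto

lemma nonneg_slope_mono:
  assumes "second_deriv_on {b..c} f f' f''" "\<And>x. x \<in> {b<..<c} \<Longrightarrow> 0 \<le> f'' x"
    and "0 \<le> f' b" "b \<le> x" "x \<le> y" "y \<le> c"
  shows "f x \<le> f y"
proof -
  have "0 \<le> f' x" using slope_mono[OF assms(1,2), of b x] assms by simp
  moreover have "f x + f' x * (y - x) \<le> f y"
    using assms(4-) by (intro tangent_below[OF assms(1,2)]) auto
  ultimately show ?thesis
    using assms(5) mult_nonneg_nonneg[of "f' x" "y - x"] by linarith
qed

lemma convex_max_at_ends:
  assumes "second_deriv_on {b..c} f f' f''" "\<And>x. x \<in> {b<..<c} \<Longrightarrow> 0 \<le> f'' x" "x \<in> {b..c}"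
  shows "f x \<le> f b \<or> f x \<le> f c"
proof (cases "0 \<le> f' x")
  case True
  then have "0 \<le> f' x * (c - x)" using assms(3) by simp
  with tangent_below[OF assms, of c] assms(3) show ?thesis by simp
next
  case False
  then have "0 \<le> f' x * (b - x)" using assms(3) by (simp add: mult_nonpos_nonpos)
  with tangent_below[OF assms, of b] assms(3) show ?thesis by simp
qed

text \<open>If \<open>f\<close> returned to zero after being negative, it would be concave on the whole excursion below
zero and therefore lie above the chord joining the two zeros.\<close>

lemma negative_stays_negative:
  assumes "second_deriv_on {b..c} f f' f''" "\<And>x. x \<in> {b..c} \<Longrightarrow> f x \<le> 0 \<Longrightarrow> f'' x \<le> 0"
    and "0 \<le> f b" "b \<le> x" "f x < 0" "x \<le> y" "y \<le> c"
  shows "f y < 0"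
proof (rule ccontr)
  assume "\<not> f y < 0"
  have cont: "continuous_on {b..c} f"
    by (rule second_deriv_on_continuous[OF assms(1)])
  define l where "l = Sup {t \<in> {b..x}. 0 \<le> f t}"
  define r where "r = Inf {t \<in> {x..y}. 0 \<le> f t}"
  have closed: "closed {t \<in> {u..v}. 0 \<le> f t}" if "{u..v} \<subseteq> {b..c}" for u v
    using continuous_closed_preimage[OF continuous_on_subset[OF cont that], of "{0..}"]
    by (simp add: vimage_def Int_def)
  have l: "l \<in> {t \<in> {b..x}. 0 \<le> f t}" unfolding l_def
    by (rule closed_contains_Sup) (use assms closed in \<open>auto intro!: bdd_aboveI[of _ x]\<close>)
  have r: "r \<in> {t \<in> {x..y}. 0 \<le> f t}" unfolding r_def
    by (rule closed_contains_Inf)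
      (use assms closed \<open>\<not> f y < 0\<close> in \<open>auto intro!: bdd_belowI[of _ x]\<close>)
  have "l < x" "x < r" using l r assms(5) by (auto simp: order_less_le)
  have neg: "f t < 0" if "t \<in> {l<..<r}" for t
  proof (cases "t \<le> x")
    case True
    then show ?thesis
      using cSup_upper[of t "{t \<in> {b..x}. 0 \<le> f t}"] l that unfolding l_def[symmetric]
      by (force intro!: bdd_aboveI[of _ x])
  next
    case False
    then show ?thesis
      using cInf_lower[of t "{t \<in> {x..y}. 0 \<le> f t}"] r that unfolding r_def[symmetric]
      by (force intro!: bdd_belowI[of _ x])
  qed
  have sub: "{l..r} \<subseteq> {b..c}" using l r assms by auto
  note sd = second_deriv_on_subset[OF assms(1) sub]
  have "- f x \<le> - f l \<or> - f x \<le> - f r"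
  proof (rule convex_max_at_ends[where f="\<lambda>t. - f t" and f'="\<lambda>t. - f' t" and f''="\<lambda>t. - f'' t"])
    show "second_deriv_on {l..r} (\<lambda>t. - f t) (\<lambda>t. - f' t) (\<lambda>t. - f'' t)"
      using sd by (auto simp: second_deriv_on_def intro: DERIV_minus)
  next
    fix t assume "t \<in> {l<..<r}"
    then show "0 \<le> - f'' t" using neg[of t] assms(2)[of t] sub by force
  qed (use \<open>l < x\<close> \<open>x < r\<close> in auto)
  then show False using l r assms(5) by auto
qed

text \<open>Quantitative blow-up for \<open>f'' \<ge> m f\<^sup>p\<close>, \<open>p = 1 + 2 q\<close>, with the power cut off at \<open>R\<close>. From height
\<open>C 2\<^sup>k\<close> the function doubles within a step proportional to \<open>2 powr (-q k)\<close>, because there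
\<open>f''\<close> is at least \<open>m (C 2\<^sup>k)\<^sup>p\<close>. The steps form a geometric series, so if they are scaled to fit
into \<open>[c, d]\<close>, every height is reached before \<open>d\<close>. The starting height \<open>C\<close> that is required
depends on \<open>m\<close> and on the length of the interval, but not on the target \<open>R\<close>.\<close>

lemma superlinear_growth_reaches:
  fixes q C R m :: real
  assumes "second_deriv_on {c..d} f f' f''" "c < d" "0 < q" "0 < C" "0 \<le> m"
    and grow: "\<And>x. x \<in> {c..d} \<Longrightarrow> C \<le> f x \<Longrightarrow> m * min (f x) R powr (2 * q) * f x \<le> f'' x"
    and large: "2 \<le> m * C powr (2 * q) * ((d - c) * (1 - 2 powr (-q)))\<^sup>2"
    and start: "C \<le> f c" "0 \<le> f' c" and conv: "\<And>x. x \<in> {c..d} \<Longrightarrow> 0 \<le> f'' x"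
  shows "R \<le> f d"
proof -
  define r where "r = (2::real) powr (-q)"
  have r: "0 < r" "r < 1" using \<open>0 < q\<close> by (auto simp: r_def powr_less_one)
  define X where "X k = c + (d - c) * (1 - r ^ k)" for k
  have X: "X k \<in> {c..d}" for k
  proof -
    have "0 \<le> r ^ k" "r ^ k \<le> 1" using r by (auto intro: power_le_one)
    then have "0 \<le> (d - c) * (1 - r ^ k)" "(d - c) * (1 - r ^ k) \<le> (d - c) * 1"
      using \<open>c < d\<close> by (auto intro!: mult_nonneg_nonneg mult_left_mono)
    then show ?thesis by (auto simp: X_def)
  qed
  have mono: "f x \<le> f y" if "c \<le> x" "x \<le> y" "y \<le> d" for x y
    by (rule nonneg_slope_mono[OF assms(1) _ start(2) that]) (use conv in auto)
  have step: "min R (C * 2 ^ k) \<le> f (X k)" for k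
  proof (induction k)
    case 0
    then show ?case using start by (simp add: X_def)
  next
    case (Suc k)
    let ?x = "X k" and ?y = "X (Suc k)"
    have diff: "?y - ?x = (d - c) * (1 - r) * r ^ k" by (simp add: X_def algebra_simps)
    have "0 \<le> (d - c) * (1 - r) * r ^ k" using r \<open>c < d\<close> by simp
    with diff have le: "?x \<le> ?y" by simp
    show ?case
    proof (cases "R \<le> f ?x")
      case True
      then show ?thesis using mono[of ?x ?y] le X[of k] X[of "Suc k"] by auto
    next
      case False
      define B where "B = C * 2 ^ k"
      have B: "0 < B" "B \<le> f ?x" "B < R" "C \<le> B" using Suc False \<open>0 < C\<close>
        by (auto simp: B_def min_def split: if_splits)
      have "m * B powr (2 * q) * B \<le> f'' x" if x: "x \<in> {?x..?y}" for x
      proof -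
        have "x \<in> {c..d}" using x X[of k] X[of "Suc k"] by auto
        have "B \<le> f x" using mono[of ?x x] x X[of k] X[of "Suc k"] B by auto
        then have "m * B powr (2 * q) * B \<le> m * min (f x) R powr (2 * q) * f x"
          using B \<open>0 \<le> m\<close> \<open>0 < q\<close>
          by (intro mult_mono mult_nonneg_nonneg powr_mono2) auto
        also have "\<dots> \<le> f'' x" using grow[OF \<open>x \<in> {c..d}\<close>] \<open>B \<le> f x\<close> B by simp
        finally show ?thesis .
      qed
      then have "f ?x + f' ?x * (?y - ?x) + (m * B powr (2 * q) * B) * (?y - ?x)\<^sup>2 / 2 \<le> f ?y"
        by (intro quadratic_lower_bound[of _ _ f f' f'']
            second_deriv_on_subset[OF assms(1)])
          (use X[of k] X[of "Suc k"] le in auto)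
      moreover have "0 \<le> f' ?x * (?y - ?x)"
        using slope_mono[OF assms(1), of c ?x] conv start X[of k] le by force
      moreover have "B \<le> (m * B powr (2 * q) * B) * (?y - ?x)\<^sup>2 / 2"
      proof -
        have "B powr (2 * q) * (r ^ k)\<^sup>2 = C powr (2 * q) * ((2 ^ k) powr (2 * q) * (r ^ k)\<^sup>2)"
          using \<open>0 < C\<close> by (simp add: B_def powr_mult)
        also have "((2::real) ^ k) powr (2 * q) * (r ^ k)\<^sup>2 = 1"
          by (simp add: r_def powr_realpow[symmetric] powr_powr powr_add[symmetric] powr_power
              algebra_simps)
        finally have "m * B powr (2 * q) * (?y - ?x)\<^sup>2
            = m * C powr (2 * q) * ((d - c) * (1 - r))\<^sup>2"
          unfolding diff by (simp add: power_mult_distrib)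
        then have "2 \<le> m * B powr (2 * q) * (?y - ?x)\<^sup>2" using large by (simp only: r_def)
        then have "B * 2 \<le> B * (m * B powr (2 * q) * (?y - ?x)\<^sup>2)"
          using B by (intro mult_left_mono) auto
        then show ?thesis by (simp add: mult_ac)
      qed
      ultimately have "2 * B \<le> f ?y" using B by linarith
      then show ?thesis by (simp add: B_def)
    qed
  qed
  obtain k where "R / C < 2 ^ k" using real_arch_pow[of 2] by auto
  then have "R \<le> C * 2 ^ k" using \<open>0 < C\<close> by (simp add: field_simps)
  with step[of k] have "R \<le> f (X k)" by (simp add: min_def)
  also have "\<dots> \<le> f d" using mono[of "X k" d] X[of k] by auto
  finally show ?thesis .
qed

text \<open>The derivative of the Wronskian \<open>f' v - f v'\<close> is \<open>f'' v - f v''\<close>. Both comparison results below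
evaluate it at the ends of an interval, for a trigonometric and for a hyperbolic \<open>v\<close>.\<close>

lemma wronskian_decreasing:
  assumes "second_deriv_on {b..c} f f' f''" "second_deriv_on {b..c} v v' v''"
    and "\<And>x. x \<in> {b<..<c} \<Longrightarrow> f'' x * v x \<le> f x * v'' x" "b \<le> c"
  shows "f' c * v c - f c * v' c \<le> f' b * v b - f b * v' b"
proof -
  have "(\<lambda>x. f' x * v x - f x * v' x) c - (\<lambda>x. f' x * v x - f x * v' x) b \<le> (\<lambda>x. 0) c - (\<lambda>x. 0) b"
    by (rule deriv_le_imp_increment_le[where f'="\<lambda>x. f'' x * v x - f x * v'' x" and g'="\<lambda>x. 0"])
      (use assms in \<open>auto simp: second_deriv_on_def intro!: derivative_eq_intros\<close>)
  then show ?thesis by simp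
qed

text \<open>Sturm comparison with the half-wave of the sine that vanishes at \<open>c\<close> and \<open>d\<close>: if \<open>f\<close> were positive
at both ends, the Wronskian would be negative at \<open>c\<close> and positive at \<open>d\<close>.\<close>

lemma sturm_oscillation:
  assumes "second_deriv_on {c..d} f f' f''" "c < d"
    and "\<And>x. x \<in> {c..d} \<Longrightarrow> f'' x \<le> - (pi / (d - c))\<^sup>2 * f x"
  shows "f c \<le> 0 \<or> f d \<le> 0"
proof (rule ccontr)
  assume "\<not> (f c \<le> 0 \<or> f d \<le> 0)"
  then have pos: "0 < f c" "0 < f d" by auto
  define w where "w = pi / (d - c)"
  have "0 < w" using \<open>c < d\<close> by (simp add: w_def)
  have wd: "w * (d - c) = pi" using \<open>c < d\<close> by (simp add: w_def)
  have sd: "second_deriv_on {c..d} (\<lambda>x. sin (w * (x - c))) (\<lambda>x. w * cos (w * (x - c)))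
     (\<lambda>x. - w\<^sup>2 * sin (w * (x - c)))"
    by (auto simp: second_deriv_on_def power2_eq_square intro!: derivative_eq_intros)
  have "f' d * sin (w * (d - c)) - f d * (w * cos (w * (d - c)))
    \<le> f' c * sin (w * (c - c)) - f c * (w * cos (w * (c - c)))"
  proof (rule wronskian_decreasing[OF assms(1) sd])
    fix x assume x: "x \<in> {c<..<d}"
    have "w * (x - c) \<le> w * (d - c)" using x \<open>0 < w\<close> by (intro mult_left_mono) auto
    then have "0 \<le> sin (w * (x - c))" using x \<open>0 < w\<close> wd by (intro sin_ge_zero) auto
    then have "f'' x * sin (w * (x - c)) \<le> - w\<^sup>2 * f x * sin (w * (x - c))"
      using assms(3)[of x] x by (intro mult_right_mono) (auto simp: w_def)
    then show "f'' x * sin (w * (x - c)) \<le> f x * (- w\<^sup>2 * sin (w * (x - c)))"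
      by (simp add: mult_ac)
  qed (use \<open>c < d\<close> in auto)
  then have "f d * w + f c * w \<le> 0" unfolding wd by simp
  moreover have "0 < f d * w" "0 < f c * w" using pos \<open>0 < w\<close> by auto
  ultimately show False by linarith
qed

text \<open>A solution of \<open>f'' \<le> k\<^sup>2 f\<close> that is nonnegative at \<open>e\<close> cannot fall faster than the solution
\<open>sinh (k (e - x))\<close> of the linear equation that vanishes at \<open>e\<close>: the quotient of the two is
nondecreasing.\<close>

lemma sinh_comparison:
  fixes k :: real
  assumes "second_deriv_on {b..e} f f' f''" "0 < k" "b \<le> x" "x < e"
    and "\<And>x. x \<in> {b<..<e} \<Longrightarrow> f'' x \<le> k\<^sup>2 * f x" and "0 \<le> f e"
  shows "f b * sinh (k * (e - x)) \<le> f x * sinh (k * (e - b))"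
proof -
  let ?v = "\<lambda>x. sinh (k * (e - x))" and ?v' = "\<lambda>x. - k * cosh (k * (e - x))"
  have sd: "second_deriv_on S ?v ?v' (\<lambda>x. k\<^sup>2 * sinh (k * (e - x)))" for S
    by (auto simp: second_deriv_on_def power2_eq_square intro!: derivative_eq_intros)
  have vpos: "0 < ?v y" if "y < e" for y using that \<open>0 < k\<close> by simp
  have W: "0 \<le> f' y * ?v y - f y * ?v' y" if y: "y \<in> {b..x}" for y
  proof -
    have "f' e * ?v e - f e * ?v' e \<le> f' y * ?v y - f y * ?v' y"
    proof (rule wronskian_decreasing[OF second_deriv_on_subset[OF assms(1)] sd])
      fix z assume "z \<in> {y<..<e}"
      then have "f'' z * ?v z \<le> k\<^sup>2 * f z * ?v z"
        using assms(5)[of z] y vpos[of z] by (intro mult_right_mono) auto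
      then show "f'' z * ?v z \<le> f z * (k\<^sup>2 * ?v z)" by (simp add: mult_ac)
    qed (use y assms in auto)
    moreover have "0 \<le> f e * k" using assms by simp
    ultimately show ?thesis by simp
  qed
  have "0 - 0 \<le> f x / ?v x - f b / ?v b"
  proof (rule deriv_le_imp_increment_le[where f="\<lambda>_. 0" and f'="\<lambda>_. 0"
        and g="\<lambda>x. f x / ?v x" and g'="\<lambda>y. (f' y * ?v y - f y * ?v' y) / (?v y * ?v y)"])
    fix y assume y: "y \<in> {b..x}"
    then have "(f has_real_derivative f' y) (at y within {b..x})"
      using second_deriv_on_subset[OF assms(1), of "{b..x}"] \<open>x < e\<close>
      by (auto simp: second_deriv_on_def)
    moreover have "(?v has_real_derivative ?v' y) (at y within {b..x})"
      using sd y unfolding second_deriv_on_def by auto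
    ultimately show "((\<lambda>x. f x / ?v x) has_real_derivative
        (f' y * ?v y - f y * ?v' y) / (?v y * ?v y)) (at y within {b..x})"
      using vpos[of y] y \<open>x < e\<close> by (intro DERIV_divide) auto
  next
    fix y assume "y \<in> {b<..<x}"
    then show "0 \<le> (f' y * ?v y - f y * ?v' y) / (?v y * ?v y)"
      using W[of y] vpos[of y] \<open>x < e\<close> by (intro divide_nonneg_nonneg) auto
  qed (use assms in auto)
  then show ?thesis using vpos[of x] vpos[of b] assms by (simp add: field_simps)
qed

text \<open>If \<open>f b\<close> were large, \<open>f\<close> would stay above \<open>K\<close> up to \<open>d\<close> by comparison with the hyperbolic sine; but
above \<open>K\<close> it oscillates too fast to remain positive across \<open>[c, d]\<close>.\<close>

lemma nonneg_solution_bound: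
  fixes k K :: real
  assumes "second_deriv_on {b..e} f f' f''" "0 < k" "0 < K"
    and "b \<le> c" "c < d" "d < e"
    and "\<And>x. x \<in> {b<..<e} \<Longrightarrow> f'' x \<le> k\<^sup>2 * f x"
    and "\<And>x. x \<in> {c..d} \<Longrightarrow> K \<le> f x \<Longrightarrow> f'' x \<le> - (pi / (d - c))\<^sup>2 * f x"
    and "0 \<le> f e"
  shows "f b * sinh (k * (e - d)) < K * sinh (k * (e - b))"
proof (rule ccontr)
  assume contr: "\<not> ?thesis"
  have ge: "K \<le> f x" if x: "x \<in> {c..d}" for x
  proof -
    have pos: "0 < sinh (k * (e - d))" "0 < sinh (k * (e - b))" using assms by auto
    have fb: "0 \<le> f b" using contr pos \<open>0 < K\<close>
      by (smt (verit) mult_less_0_iff mult_pos_pos)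
    have "K * sinh (k * (e - b)) \<le> f b * sinh (k * (e - d))" using contr by simp
    also have "\<dots> \<le> f b * sinh (k * (e - x))"
      using fb x \<open>0 < k\<close> by (intro mult_left_mono) auto
    also have "\<dots> \<le> f x * sinh (k * (e - b))"
      using assms x by (intro sinh_comparison[OF assms(1)]) auto
    finally show ?thesis using pos by simp
  qed
  have "f c \<le> 0 \<or> f d \<le> 0"
    by (rule sturm_oscillation[OF second_deriv_on_subset[OF assms(1)], of c d])
      (use assms ge in auto)
  with ge[of c] ge[of d] \<open>0 < K\<close> \<open>c < d\<close> show False by auto
qed

section \<open>Global solutions of the initial value problems\<close>

text \<open>Integrating \<open>exp (\<beta> t)\<close> twice gains the factor \<open>1 / \<beta>\<^sup>2\<close>; this is what makes a Picard operator
contract in an exponentially weighted norm.\<close>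

lemma picard_estimate:
  fixes \<beta> D :: real
  assumes "second_deriv_on {0..x} f f' f''" "f 0 = 0" "f' 0 = 0" "0 < \<beta>" "0 \<le> D" "0 \<le> x"
    and "\<And>t. t \<in> {0..x} \<Longrightarrow> f'' t \<le> D * exp (\<beta> * t)"
  shows "f x \<le> D / \<beta>\<^sup>2 * exp (\<beta> * x)"
proof -
  have slope: "f' t \<le> D / \<beta> * exp (\<beta> * t)" if t: "t \<in> {0..x}" for t
  proof -
    have "f' t - f' 0 \<le> D / \<beta> * exp (\<beta> * t) - D / \<beta> * exp (\<beta> * 0)"
      by (rule deriv_le_imp_increment_le[where f'=f'' and g'="\<lambda>t. D * exp (\<beta> * t)"])
        (use second_deriv_on_subset[OF assms(1), of "{0..t}"] assms t
          in \<open>auto simp: second_deriv_on_def intro!: derivative_eq_intros\<close>)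
    also have "\<dots> \<le> D / \<beta> * exp (\<beta> * t)" using assms by simp
    finally show ?thesis using assms by simp
  qed
  have "f x - f 0 \<le> D / \<beta>\<^sup>2 * exp (\<beta> * x) - D / \<beta>\<^sup>2 * exp (\<beta> * 0)"
    by (rule deriv_le_imp_increment_le[where f'=f' and g'="\<lambda>t. D / \<beta> * exp (\<beta> * t)"])
      (use assms slope in \<open>auto simp: second_deriv_on_def power2_eq_square intro!: derivative_eq_intros\<close>)
  also have "\<dots> \<le> D / \<beta>\<^sup>2 * exp (\<beta> * x)" using assms by simp
  finally show ?thesis using assms by simp
qed

lemma double_integral_second_deriv:
  fixes h :: "real \<Rightarrow> real"
  assumes "continuous_on {0..L} h"
  shows "second_deriv_on {0..L} (\<lambda>x. s * x + integral {0..x} (\<lambda>t. integral {0..t} h))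
    (\<lambda>x. s + integral {0..x} h) h"
proof -
  have d1: "((\<lambda>x. integral {0..x} h) has_real_derivative h x) (at x within {0..L})"
    if "x \<in> {0..L}" for x
    using integral_has_real_derivative[OF assms that] .
  then have "continuous_on {0..L} (\<lambda>x. integral {0..x} h)"
    by (blast intro: DERIV_continuous_on)
  then have d2: "((\<lambda>x. integral {0..x} (\<lambda>t. integral {0..t} h)) has_real_derivative integral {0..x} h)
    (at x within {0..L})" if "x \<in> {0..L}" for x
    using integral_has_real_derivative that by blast
  show ?thesis
    unfolding second_deriv_on_def by (auto intro!: derivative_eq_intros d1 d2)
qed

text \<open>The initial value problems \<open>u'' = F x u\<close>, \<open>u 0 = 0\<close>, \<open>u' 0 = s\<close> are solved on all of \<open>[0, L]\<close> by
Banach's theorem. The fixed point is sought for \<open>w x = exp (- \<beta> x) u x\<close>; the contraction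
constant is the same for all slopes \<open>s\<close>, which gives Lipschitz dependence on \<open>s\<close>.\<close>

lemma shooting_family:
  fixes F :: "real \<Rightarrow> real \<Rightarrow> real" and L K :: real
  assumes "0 < L" "continuous_on ({0..L} \<times> UNIV) (\<lambda>(x, y). F x y)"
    and lipschitz: "\<And>x y z. x \<in> {0..L} \<Longrightarrow> \<bar>F x y - F x z\<bar> \<le> K * \<bar>y - z\<bar>"
    and zero: "\<And>x. x \<in> {0..L} \<Longrightarrow> F x 0 = 0"
  obtains U V B where "\<And>s. second_deriv_on {0..L} (U s) (V s) (\<lambda>x. F x (U s x))"
    and "\<And>s. U s 0 = 0" "\<And>s. V s 0 = s" "\<And>x. x \<in> {0..L} \<Longrightarrow> U 0 x = 0"
    and "\<And>s t x. x \<in> {0..L} \<Longrightarrow> \<bar>U s x - U t x\<bar> \<le> B * \<bar>s - t\<bar>"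
proof -
  define M where "M = max K 1"
  have "0 < M" by (simp add: M_def)
  have lip: "\<bar>F x y - F x z\<bar> \<le> M * \<bar>y - z\<bar>" if "x \<in> {0..L}" for x y z
    using lipschitz[OF that, of y z] mult_right_mono[of K M "\<bar>y - z\<bar>"] by (auto simp: M_def)
  \<comment> \<open>With this weight \<open>M / \<beta>\<^sup>2\<close>, the contraction constant, is 1/2.\<close>
  define \<beta> where "\<beta> = sqrt (2 * M)"
  have \<beta>: "0 < \<beta>" "\<beta>\<^sup>2 = 2 * M" using \<open>0 < M\<close> by (auto simp: \<beta>_def)
  define h where "h w r = F r (exp (\<beta> * r) * w r)" for w r
  define I where "I s w x = s * x + integral {0..x} (\<lambda>t. integral {0..t} (h w))" for s w x
  \<comment> \<open>Bounded continuous functions live on the whole line, so points are first moved into \<open>[0, L]\<close>.\<close>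
  define cl where "cl x = max 0 (min L x)" for x
  have cl: "cl x \<in> {0..L}" "x \<in> {0..L} \<Longrightarrow> cl x = x" for x using \<open>0 < L\<close> by (auto simp: cl_def)
  define T where "T s w x = exp (- \<beta> * cl x) * I s w (cl x)" for s w x
  have cont_h: "continuous_on {0..L} (h w)" if "continuous_on UNIV w" for w
  proof -
    have "continuous_on {0..L} (\<lambda>r. (r, exp (\<beta> * r) * w r))"
      by (intro continuous_intros continuous_on_subset[OF that]) auto
    from continuous_on_compose2[OF assms(2) this] show ?thesis by (auto simp: h_def)
  qed
  have sd: "second_deriv_on {0..L} (I s w) (\<lambda>x. s + integral {0..x} (h w)) (h w)"
    if "continuous_on UNIV w" for s w
    unfolding I_def by (rule double_integral_second_deriv[OF cont_h[OF that]])
  have T_bcont: "T s w \<in> bcontfun" if "continuous_on UNIV w" for s w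
  proof -
    have I: "continuous_on {0..L} (I s w)"
      by (rule second_deriv_on_continuous[OF sd[OF that]])
    then have g: "continuous_on {0..L} (\<lambda>x. exp (- \<beta> * x) * I s w x)"
      by (intro continuous_intros)
    have "continuous_on UNIV (T s w)" unfolding T_def
      by (rule continuous_on_compose2[OF g]) (use cl in \<open>auto simp: cl_def intro!: continuous_intros\<close>)
    moreover have "bounded (range (T s w))"
      by (rule bounded_subset[OF compact_imp_bounded[OF compact_continuous_image[OF g compact_Icc]]])
        (use cl in \<open>auto simp: T_def\<close>)
    ultimately show ?thesis by (simp add: bcontfun_def)
  qed
  have T_contr: "\<bar>T s v x - T s w x\<bar> \<le> D / 2"
    if v: "continuous_on UNIV v" and w: "continuous_on UNIV w"
      and D: "\<And>x. \<bar>v x - w x\<bar> \<le> D" for s v w x D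
  proof -
    have le: "I s v y - I s w y \<le> D / 2 * exp (\<beta> * y)" if y: "y \<in> {0..L}"
      and v: "continuous_on UNIV v" and w: "continuous_on UNIV w"
      and D: "\<And>x. \<bar>v x - w x\<bar> \<le> D" for v w y
    proof -
      have "I s v y - I s w y \<le> (M * D) / \<beta>\<^sup>2 * exp (\<beta> * y)"
      proof (rule picard_estimate[where f="\<lambda>y. I s v y - I s w y"
            and f'="\<lambda>x. (s + integral {0..x} (h v)) - (s + integral {0..x} (h w))"
            and f''="\<lambda>x. h v x - h w x"])
        have "{0..y} \<subseteq> {0..L}" using y by auto
        show "second_deriv_on {0..y} (\<lambda>y. I s v y - I s w y)
          (\<lambda>x. (s + integral {0..x} (h v)) - (s + integral {0..x} (h w))) (\<lambda>x. h v x - h w x)"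
          by (intro second_deriv_on_diff second_deriv_on_subset[OF sd] v w) fact+
      next
        fix t assume "t \<in> {0..y}"
        then have "\<bar>h v t - h w t\<bar> \<le> M * \<bar>exp (\<beta> * t) * v t - exp (\<beta> * t) * w t\<bar>"
          using lip y by (auto simp: h_def)
        also have "\<dots> = M * exp (\<beta> * t) * \<bar>v t - w t\<bar>"
          by (simp add: right_diff_distrib[symmetric] abs_mult)
        also have "\<dots> \<le> M * exp (\<beta> * t) * D"
          using D \<open>0 < M\<close> by (intro mult_left_mono) auto
        finally show "h v t - h w t \<le> M * D * exp (\<beta> * t)" by (simp add: mult_ac)
      next
        show "0 \<le> M * D" using D[of 0] \<open>0 < M\<close> by simp
      qed (use \<beta> y in \<open>auto simp: I_def\<close>)
      also have "(M * D) / \<beta>\<^sup>2 = D / 2" using \<beta> \<open>0 < M\<close> by simp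
      finally show ?thesis .
    qed
    have "\<bar>I s v (cl x) - I s w (cl x)\<bar> \<le> D / 2 * exp (\<beta> * cl x)"
    proof -
      have "\<bar>w y - v y\<bar> \<le> D" for y using D[of y] by (simp add: abs_minus_commute)
      from le[OF cl(1) v w D, of x] le[OF cl(1) w v this, of x] show ?thesis by linarith
    qed
    then have "exp (- \<beta> * cl x) * \<bar>I s v (cl x) - I s w (cl x)\<bar>
      \<le> exp (- \<beta> * cl x) * (D / 2 * exp (\<beta> * cl x))" by (intro mult_left_mono) auto
    also have "\<dots> = D / 2" by (simp add: exp_minus)
    finally show ?thesis by (simp add: T_def right_diff_distrib[symmetric] abs_mult)
  qed
  define TT where "TT s w = Bcontfun (T s (apply_bcontfun w))" for s and w :: "real \<Rightarrow>\<^sub>C real"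
  have cw: "continuous_on UNIV (apply_bcontfun w)" for w :: "real \<Rightarrow>\<^sub>C real"
    using apply_bcontfun[of w] by (simp add: bcontfun_def)
  have TT: "apply_bcontfun (TT s w) = T s (apply_bcontfun w)" for s w
    unfolding TT_def using T_bcont[OF cw] by (rule Bcontfun_inverse)
  have contr: "dist (TT s v) (TT s w) \<le> 1/2 * dist v w" for s v w
  proof (rule dist_bound)
    fix x show "dist (apply_bcontfun (TT s v) x) (apply_bcontfun (TT s w) x) \<le> 1/2 * dist v w"
      using T_contr[OF cw cw, of v w "dist v w" s x] dist_bounded[of v _ w]
      by (simp add: TT dist_real_def)
  qed
  have "\<exists>w. TT s w = w" for s
    using banach_fix_type[of "1/2" "TT s"] contr by auto
  then obtain W where W: "\<And>s. TT s (W s) = W s" by metis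
  define w where "w s = apply_bcontfun (W s)" for s
  have w: "w s = T s (w s)" for s using W[of s] TT[of s "W s"] by (simp add: w_def)
  define U where "U s x = I s (w s) x" for s x
  have hU: "h (w s) x = F x (U s x)" if "x \<in> {0..L}" for s x
    unfolding h_def using that
    by (subst w) (simp add: T_def U_def cl exp_minus field_simps)
  show thesis
  proof (rule that[of U "\<lambda>s x. s + integral {0..x} (h (w s))" "2 * L * exp (\<beta> * L)"])
    show "second_deriv_on {0..L} (U s) (\<lambda>x. s + integral {0..x} (h (w s))) (\<lambda>x. F x (U s x))" for s
      using sd[of "w s" s] hU[of _ s] cw[of "W s"]
      by (simp add: second_deriv_on_def U_def[abs_def] w_def)
  next
    have "TT 0 0 = 0"
    proof (rule bcontfun_eqI)
      fix x
      have "integral {0..t} (h (\<lambda>_. 0)) = integral {0..t} (\<lambda>_. 0)" if "t \<in> {0..cl x}" for t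
        by (rule integral_cong) (use zero that cl(1)[of x] in \<open>auto simp: h_def\<close>)
      then have "integral {0..cl x} (\<lambda>t. integral {0..t} (h (\<lambda>_. 0))) = integral {0..cl x} (\<lambda>_. 0)"
        by (intro integral_cong) simp
      then show "apply_bcontfun (TT 0 0) x = apply_bcontfun 0 x"
        by (simp add: TT T_def I_def)
    qed
    with contr[of 0 "W 0" 0] W[of 0] have "W 0 = 0" by simp
    then have "w 0 x = 0" for x by (simp add: w_def)
    then show "U 0 x = 0" if "x \<in> {0..L}" for x
      using fun_cong[OF w[of 0], of x] cl(2)[OF that] by (simp add: U_def T_def)
  next
    fix s t x assume x: "x \<in> {0..L}"
    have "dist (TT s (W t)) (TT t (W t)) \<le> \<bar>s - t\<bar> * L"
    proof (rule dist_bound)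
      fix y
      have "T s (w t) y - T t (w t) y = exp (- \<beta> * cl y) * ((s - t) * cl y)"
        by (simp add: T_def I_def algebra_simps)
      then have "\<bar>T s (w t) y - T t (w t) y\<bar> = exp (- \<beta> * cl y) * (\<bar>s - t\<bar> * cl y)"
        using cl(1)[of y] by (simp add: abs_mult)
      also have "\<dots> \<le> 1 * (\<bar>s - t\<bar> * L)"
        using cl(1)[of y] \<beta> by (intro mult_mono) auto
      finally show "dist (apply_bcontfun (TT s (W t)) y) (apply_bcontfun (TT t (W t)) y) \<le> \<bar>s - t\<bar> * L"
        by (simp add: TT w_def dist_real_def)
    qed
    moreover have "dist (W s) (W t) \<le> dist (TT s (W s)) (TT s (W t)) + dist (TT s (W t)) (TT t (W t))"
      using dist_triangle[of "TT s (W s)" "TT t (W t)" "TT s (W t)"] W by simp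
    ultimately have "dist (W s) (W t) \<le> 2 * (\<bar>s - t\<bar> * L)"
      using contr[of s "W s" "W t"] by simp
    then have "\<bar>w s x - w t x\<bar> \<le> 2 * L * \<bar>s - t\<bar>"
      using dist_bounded[of "W s" x "W t"] by (simp add: w_def dist_real_def mult_ac)
    moreover have "U r x = exp (\<beta> * x) * w r x" for r
    proof -
      have "w r x = exp (- \<beta> * x) * U r x"
        using fun_cong[OF w[of r], of x] cl(2)[OF x] by (simp only: U_def T_def)
      then show ?thesis by (simp add: exp_minus)
    qed
    ultimately have "\<bar>U s x - U t x\<bar> = exp (\<beta> * x) * \<bar>w s x - w t x\<bar>"
      by (simp add: right_diff_distrib[symmetric] abs_mult)
    also have "\<dots> \<le> exp (\<beta> * L) * (2 * L * \<bar>s - t\<bar>)"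
      using \<open>\<bar>w s x - w t x\<bar> \<le> _\<close> x \<beta> by (intro mult_mono) auto
    finally show "\<bar>U s x - U t x\<bar> \<le> 2 * L * exp (\<beta> * L) * \<bar>s - t\<bar>" by (simp add: mult_ac)
  qed (simp_all add: U_def I_def)
qed

section \<open>Counting the zeros of the shooting map\<close>

lemma ivt_closed_segment:
  fixes g :: "real \<Rightarrow> real"
  assumes "continuous_on UNIV g" "g s \<le> c" "c \<le> g t"
  shows "\<exists>m\<in>closed_segment s t. g m = c"
proof (cases "s \<le> t")
  case True
  then show ?thesis
    using IVT'[OF assms(2,3) True continuous_on_subset[OF assms(1)]]
    by (auto simp: closed_segment_eq_real_ivl)
next
  case False
  then show ?thesis
    using IVT2'[OF assms(2,3) _ continuous_on_subset[OF assms(1)]]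
    by (auto simp: closed_segment_eq_real_ivl)
qed

text \<open>The alternating partition of \<open>[0, L]\<close> into wells \<open>[\<sigma> i, \<tau> i]\<close>, where the weight is positive, and gaps
\<open>[\<tau> i, \<sigma> (i + 1)]\<close>, where it is negative; the two outer gaps may be single points.\<close>

locale well_geometry =
  fixes L :: real and n :: nat and \<sigma> \<tau> :: "nat \<Rightarrow> real"
  assumes n_pos: "1 \<le> n" and \<tau>_0: "\<tau> 0 = 0" and \<sigma>_end: "\<sigma> (Suc n) = L"
    and well: "\<And>i. 1 \<le> i \<Longrightarrow> i \<le> n \<Longrightarrow> \<sigma> i < \<tau> i"
    and gap: "\<And>i. i \<le> n \<Longrightarrow> \<tau> i \<le> \<sigma> (Suc i)"
begin

lemma \<tau>_mono: "i \<le> j \<Longrightarrow> j \<le> n \<Longrightarrow> \<tau> i \<le> \<tau> j"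
proof (induction j rule: dec_induct)
  case (step j)
  then show ?case using gap[of j] well[of "Suc j"] by simp
qed simp

lemma \<tau>_range: "i \<le> n \<Longrightarrow> 0 \<le> \<tau> i \<and> \<tau> i \<le> L"
  using \<tau>_mono[of 0 i] \<tau>_mono[of i n] gap[of n] \<tau>_0 \<sigma>_end by auto

lemma \<sigma>_range: "1 \<le> i \<Longrightarrow> i \<le> Suc n \<Longrightarrow> 0 \<le> \<sigma> i \<and> \<sigma> i \<le> L"
proof -
  assume i: "1 \<le> i" "i \<le> Suc n"
  then obtain j where j: "i = Suc j" by (cases i) auto
  show ?thesis
    using \<tau>_range[of j] gap[of j] well[of i] \<tau>_range[of i] \<sigma>_end i
    unfolding j by (cases "j = n") auto
qed

lemma L_pos: "0 < L"
  using well[of 1] \<sigma>_range[of 1] \<tau>_range[of 1] n_pos by auto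

lemma well_subset: "1 \<le> i \<Longrightarrow> i \<le> n \<Longrightarrow> {\<sigma> i..\<tau> i} \<subseteq> {0..L}"
  using \<sigma>_range[of i] \<tau>_range[of i] by auto

lemma gap_subset: "i \<le> n \<Longrightarrow> {\<tau> i..\<sigma> (Suc i)} \<subseteq> {0..L}"
  using \<sigma>_range[of "Suc i"] \<tau>_range[of i] by auto

lemma gap_or_well:
  assumes "x \<in> {0..L}"
  obtains (in_well) i where "1 \<le> i" "i \<le> n" "x \<in> {\<sigma> i..\<tau> i}"
    | (in_gap) i where "i \<le> n" "x \<in> {\<tau> i..\<sigma> (Suc i)}"
proof (cases "x \<in> {\<tau> n..L}")
  case True
  then show thesis using gap[of n] \<sigma>_end that(2)[of n] by auto
next
  case False
  define i where "i = (LEAST i. x < \<tau> i)"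
  have "x < \<tau> n" using False assms by auto
  then have i: "x < \<tau> i" "i \<le> n" unfolding i_def by (auto intro: LeastI Least_le)
  have "i \<noteq> 0" using i(1) assms \<tau>_0 by (metis atLeastAtMost_iff not_le)
  then obtain j where j: "i = Suc j" by (cases i) auto
  have "\<tau> j \<le> x" using not_less_Least[of j "\<lambda>i. x < \<tau> i"] j unfolding i_def by auto
  with i j that(1)[of i] that(2)[of j] show thesis by (cases "x \<le> \<sigma> i") auto
qed

end

text \<open>Everything that the counting argument uses about the equation \<open>u'' = F x u\<close> and its solutions
\<open>U s\<close> of initial slope \<open>s\<close> (with derivative \<open>V s\<close>). Solutions are convex in the gaps and, everywhere,
below the height \<open>C\<close>. The two heights \<open>C \<le> R\<close> play opposite roles: in a well, a nonnegative solution
cannot reach \<open>R\<close>; in an inner gap, a solution that enters at height \<open>C\<close> or more without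
descending leaves it above \<open>R\<close>, from left to right as well as from right to left.\<close>

locale well_chain = well_geometry L n \<sigma> \<tau>
  for L :: real and n :: nat and \<sigma> \<tau> :: "nat \<Rightarrow> real" +
  fixes R C G B :: real and F U V :: "real \<Rightarrow> real \<Rightarrow> real"
  assumes C_pos: "0 < C" and C_le_R: "C \<le> R" and G_nonneg: "0 \<le> G"
    and F_nonpos: "\<And>x y. y \<le> 0 \<Longrightarrow> F x y = 0"
    and F_gap: "\<And>i x y. i \<le> n \<Longrightarrow> x \<in> {\<tau> i<..<\<sigma> (Suc i)} \<Longrightarrow> 0 \<le> F x y"
    and F_small: "\<And>x y. x \<in> {0..L} \<Longrightarrow> y \<le> C \<Longrightarrow> 0 \<le> F x y"
    and F_lower: "\<And>x y. x \<in> {0..L} \<Longrightarrow> y \<le> R \<Longrightarrow> - G \<le> F x y"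
    and well_bound: "\<And>i f f' x. 1 \<le> i \<Longrightarrow> i \<le> n \<Longrightarrow>
      second_deriv_on {\<sigma> i..\<tau> i} f f' (\<lambda>x. F x (f x)) \<Longrightarrow>
      (\<And>x. x \<in> {\<sigma> i..\<tau> i} \<Longrightarrow> 0 \<le> f x) \<Longrightarrow> x \<in> {\<sigma> i..\<tau> i} \<Longrightarrow> f x < R"
    and grow_right: "\<And>i f f'. 1 \<le> i \<Longrightarrow> i < n \<Longrightarrow>
      second_deriv_on {\<tau> i..\<sigma> (Suc i)} f f' (\<lambda>x. F x (f x)) \<Longrightarrow>
      C \<le> f (\<tau> i) \<Longrightarrow> 0 \<le> f' (\<tau> i) \<Longrightarrow> R \<le> f (\<sigma> (Suc i))"
    and grow_left: "\<And>i f f'. 1 \<le> i \<Longrightarrow> i < n \<Longrightarrow>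
      second_deriv_on {\<tau> i..\<sigma> (Suc i)} f f' (\<lambda>x. F x (f x)) \<Longrightarrow>
      C \<le> f (\<sigma> (Suc i)) \<Longrightarrow> f' (\<sigma> (Suc i)) \<le> 0 \<Longrightarrow> R \<le> f (\<tau> i)"
    and U_ode: "\<And>s. second_deriv_on {0..L} (U s) (V s) (\<lambda>x. F x (U s x))"
    and U_init: "\<And>s. U s 0 = 0" "\<And>s. V s 0 = s"
    and U_zero: "\<And>x. x \<in> {0..L} \<Longrightarrow> U 0 x = 0"
    and U_lipschitz: "\<And>s t x. x \<in> {0..L} \<Longrightarrow> \<bar>U s x - U t x\<bar> \<le> B * \<bar>s - t\<bar>"
begin

lemmas U_ode_well = second_deriv_on_subset[OF U_ode well_subset]
lemmas U_ode_gap = second_deriv_on_subset[OF U_ode gap_subset]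

lemma U_stays_negative: "0 \<le> x \<Longrightarrow> U s x < 0 \<Longrightarrow> x \<le> y \<Longrightarrow> y \<le> L \<Longrightarrow> U s y < 0"
  by (rule negative_stays_negative[OF U_ode]) (auto simp: F_nonpos U_init)

lemma U_nonneg_before: "0 \<le> U s y \<Longrightarrow> y \<le> L \<Longrightarrow> 0 \<le> x \<Longrightarrow> x \<le> y \<Longrightarrow> 0 \<le> U s x"
  using U_stays_negative[of x s y] by linarith

lemma U_well_bound:
  assumes "1 \<le> i" "i \<le> n" "0 \<le> U s (\<tau> i)" "x \<in> {\<sigma> i..\<tau> i}"
  shows "U s x < R"
  by (rule well_bound[OF assms(1,2) U_ode_well[OF assms(1,2)] _ assms(4)])
    (use U_nonneg_before[OF assms(3)] \<tau>_range[of i] \<sigma>_range[of i] assms in force)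

text \<open>Below \<open>C\<close> the solution is convex, so its maximum over the well is attained at an end. At the left
end it would be descending. Followed to the left it then rises across the gap: in the first gap this is
absurd because the solution starts from zero, and in an inner gap it would exceed \<open>R\<close> at the end of
the preceding well, where it is confined below \<open>R\<close>.\<close>

lemma U_tall_at_end_of_well:
  assumes i: "1 \<le> i" "i \<le> n"
    and le: "\<And>x. x \<in> {\<sigma> i..\<tau> i} \<Longrightarrow> U s x \<le> C"
    and ge: "z \<in> {\<sigma> i..\<tau> i}" "C \<le> U s z"
  shows "U s (\<tau> i) = C" and "0 \<le> V s (\<tau> i)"
proof -
  have lt: "\<sigma> i < \<tau> i" by (rule well[OF i])
  have conv: "0 \<le> F x (U s x)" if "x \<in> {\<sigma> i<..<\<tau> i}" for x
    using that le[of x] well_subset[OF i] by (intro F_small) auto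
  note tangent = tangent_below[OF U_ode_well[OF i] conv]
  show top: "U s (\<tau> i) = C"
  proof (rule ccontr)
    assume "U s (\<tau> i) \<noteq> C"
    then have less: "U s (\<tau> i) < C" using le[of "\<tau> i"] lt by auto
    have "U s z \<le> U s (\<sigma> i) \<or> U s z \<le> U s (\<tau> i)"
      using ge(1) by (intro convex_max_at_ends[OF U_ode_well[OF i] conv])
    then have \<sigma>: "U s (\<sigma> i) = C" using less ge(2) le[of "\<sigma> i"] lt by auto
    have "V s (\<sigma> i) * (\<tau> i - \<sigma> i) < 0"
      using tangent[of "\<sigma> i" "\<tau> i"] \<sigma> less lt by auto
    then have slope: "V s (\<sigma> i) < 0" using lt by (simp add: mult_less_0_iff)
    obtain j where j: "i = Suc j" "j \<le> n" using i by (cases i) auto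
    show False
    proof (cases "j = 0")
      case True
      have "U s (\<sigma> i) + V s (\<sigma> i) * (\<tau> 0 - \<sigma> i) \<le> U s (\<tau> 0)"
        by (rule tangent_below[OF U_ode_gap[of 0] F_gap[of 0]]) (use True j gap[of 0] in auto)
      moreover have "0 \<le> V s (\<sigma> i) * (\<tau> 0 - \<sigma> i)"
        using slope gap[of 0] True j by (intro mult_nonpos_nonpos) auto
      ultimately show False using \<sigma> C_pos \<tau>_0 U_init by simp
    next
      case False
      then have j1: "1 \<le> j" "j < n" using j i by auto
      have "R \<le> U s (\<tau> j)"
        by (rule grow_left[OF j1 U_ode_gap]) (use j j1 \<sigma> slope in auto)
      moreover have "U s (\<tau> j) < R"
        by (rule U_well_bound[OF j1(1) j(2)])
          (use U_nonneg_before[of s "\<sigma> i" "\<tau> j"] \<sigma> C_pos \<sigma>_range[of i] i \<tau>_range[of j]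
            gap[of j] j well[OF j1(1) j(2)] in auto)
      ultimately show False by simp
    qed
  qed
  have "V s (\<tau> i) * (\<sigma> i - \<tau> i) \<le> 0"
    using tangent[of "\<tau> i" "\<sigma> i"] top le[of "\<sigma> i"] lt by auto
  then show "0 \<le> V s (\<tau> i)" using lt by (simp add: mult_le_0_iff)
qed

text \<open>The two kinds of slopes between which the search takes place at each stage: the solution is already lost
before well \<open>i\<close> (or trivial), or it makes a high excursion in well \<open>i\<close> and is lost there. The stage
\<open>n + 1\<close> stands for the end point \<open>L\<close>, where the two kinds are told apart by the sign of \<open>U s L\<close>.\<close>

definition low :: "nat \<Rightarrow> real \<Rightarrow> bool" where
  "low i s \<longleftrightarrow> s = 0 \<or> U s (\<sigma> i) < 0"

definition high :: "nat \<Rightarrow> real \<Rightarrow> bool" where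
  "high i s \<longleftrightarrow> (if i \<le> n then U s (\<tau> i) < 0 \<and> (\<exists>x\<in>{\<sigma> i..\<tau> i}. C \<le> U s x) else 0 < U s L)"

lemma U_continuous: "x \<in> {0..L} \<Longrightarrow> continuous_on UNIV (\<lambda>s. U s x)"
proof -
  assume x: "x \<in> {0..L}"
  have "0 \<le> B" using U_lipschitz[OF x, of 0 1] by simp
  then have "B-lipschitz_on UNIV (\<lambda>s. U s x)"
    using U_lipschitz[OF x] by (auto simp: lipschitz_on_def dist_real_def)
  then show ?thesis by (rule lipschitz_on_continuous_on)
qed

text \<open>The maximum of \<open>U r\<close> over the well depends continuously on \<open>r\<close>; it is at most \<open>0\<close> for a low slope and
at least \<open>C\<close> for a high one. A slope for which it equals \<open>C\<close> gives a solution that grows through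
the right end of the well.\<close>

lemma turning_slope:
  assumes i: "1 \<le> i" "i \<le> n" and "low i s" "high i t"
  obtains m where "m \<in> open_segment s t" "U m (\<tau> i) = C" "0 \<le> V m (\<tau> i)"
proof -
  define W where "W = {\<sigma> i..\<tau> i}"
  have W: "compact W" "W \<noteq> {}" "W \<subseteq> {0..L}"
    using well[OF i] well_subset[OF i] by (auto simp: W_def)
  define \<Psi> where "\<Psi> r = Sup (U r ` W)" for r
  have cont: "continuous_on W (U r)" for r
    by (rule continuous_on_subset[OF second_deriv_on_continuous[OF U_ode] W(3)])
  have bdd: "bdd_above (U r ` W)" for r
    by (intro bounded_imp_bdd_above compact_imp_bounded compact_continuous_image cont W)
  have upper: "x \<in> W \<Longrightarrow> U r x \<le> \<Psi> r" for r x
    unfolding \<Psi>_def by (rule cSUP_upper[OF _ bdd])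
  have attained: "\<exists>x\<in>W. U r x = \<Psi> r" for r
  proof -
    obtain x where x: "x \<in> W" "\<And>y. y \<in> W \<Longrightarrow> U r y \<le> U r x"
      using continuous_attains_sup[OF W(1,2) cont] by blast
    then have "\<Psi> r \<le> U r x" unfolding \<Psi>_def by (intro cSUP_least W) auto
    with upper[OF x(1), of r] x(1) show ?thesis by force
  qed
  have "0 \<le> B" using U_lipschitz[of 0 0 1] L_pos by simp
  have le: "\<Psi> r \<le> \<Psi> r' + B * \<bar>r - r'\<bar>" for r r'
  proof -
    obtain x where "x \<in> W" "U r x = \<Psi> r" using attained by blast
    then show ?thesis using U_lipschitz[of x r r'] upper[of x r'] W(3) by (auto simp: abs_le_iff)
  qed
  have "B-lipschitz_on UNIV \<Psi>"
  proof (rule lipschitz_onI)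
    fix r r'
    have "\<Psi> r \<le> \<Psi> r' + B * \<bar>r - r'\<bar>" "\<Psi> r' \<le> \<Psi> r + B * \<bar>r - r'\<bar>"
      using le[of r r'] le[of r' r] by (simp_all add: abs_minus_commute)
    then show "dist (\<Psi> r) (\<Psi> r') \<le> B * dist r r'" by (simp add: dist_real_def)
  qed (rule \<open>0 \<le> B\<close>)
  then have "continuous_on UNIV \<Psi>" by (rule lipschitz_on_continuous_on)
  moreover have s: "\<Psi> s \<le> 0"
  proof -
    obtain x where x: "x \<in> W" "U s x = \<Psi> s" using attained by blast
    then show ?thesis
      using \<open>low i s\<close> U_zero[of x] U_stays_negative[of "\<sigma> i" s x] \<sigma>_range[of i] i W(3)
      by (force simp: low_def W_def)
  qed
  moreover have t: "C \<le> \<Psi> t" "U t (\<tau> i) < 0"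
    using \<open>high i t\<close> i upper[of _ t] by (force simp: high_def W_def)+
  ultimately obtain m where m: "m \<in> closed_segment s t" "\<Psi> m = C"
    using ivt_closed_segment[of \<Psi> s C t] C_pos by auto
  obtain z where z: "z \<in> {\<sigma> i..\<tau> i}" "C \<le> U m z"
    using attained[of m] m(2) by (auto simp: W_def)
  have le: "x \<in> {\<sigma> i..\<tau> i} \<Longrightarrow> U m x \<le> C" for x
    using upper[of x m] m(2) by (auto simp: W_def)
  note tall = U_tall_at_end_of_well[OF i le z]
  have "m \<noteq> s" "m \<noteq> t" using s m(2) t tall(1) C_pos by auto
  with m(1) tall show thesis by (intro that) (auto simp: open_segment_def)
qed

text \<open>The solution crosses the following gap upwards and enters the next well above \<open>R\<close>, hence it must
become negative in that well. After the last well it just stays positive up to \<open>L\<close>.\<close>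

lemma high_Suc:
  assumes i: "1 \<le> i" "i \<le> n" and "C \<le> U m (\<tau> i)" "0 \<le> V m (\<tau> i)"
  shows "high (Suc i) m"
proof (cases "i = n")
  case True
  have "U m (\<tau> n) \<le> U m (\<sigma> (Suc n))"
    by (rule nonneg_slope_mono[OF U_ode_gap[of n] F_gap[of n]]) (use assms True gap[of n] in auto)
  then show ?thesis using True assms C_pos \<sigma>_end by (simp add: high_def)
next
  case False
  then have lt: "i < n" using i by simp
  have R: "R \<le> U m (\<sigma> (Suc i))"
    by (rule grow_right[OF i(1) lt U_ode_gap]) (use assms in auto)
  have "U m (\<tau> (Suc i)) < 0"
    using U_well_bound[of "Suc i" m "\<sigma> (Suc i)"] R lt well[of "Suc i"] by force
  then show ?thesis using R C_le_R lt well[of "Suc i"] by (force simp: high_def)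
qed

lemma low_Suc: "1 \<le> i \<Longrightarrow> i \<le> n \<Longrightarrow> low i s \<Longrightarrow> low (Suc i) s"
  using U_stays_negative[of "\<sigma> i" s "\<sigma> (Suc i)"] \<sigma>_range[of i] \<sigma>_range[of "Suc i"]
    well[of i] gap[of i] by (auto simp: low_def)

lemma high_imp_low_Suc: "1 \<le> i \<Longrightarrow> i \<le> n \<Longrightarrow> high i t \<Longrightarrow> low (Suc i) t"
  using U_stays_negative[of "\<tau> i" t "\<sigma> (Suc i)"] \<tau>_range[of i] \<sigma>_range[of "Suc i"]
    gap[of i] by (auto simp: low_def high_def)

text \<open>Both \<open>s\<close> and \<open>t\<close> are low for the next stage and the turning slope \<open>m\<close> between them is high, so the
interval splits in two at every stage and the count doubles. In the end every interval contains a sign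
change of \<open>U z L\<close>, except possibly the one that starts at the trivial slope \<open>0\<close>.\<close>

lemma many_zeros_between:
  assumes "i \<le> Suc n" "1 \<le> i" "low i s" "high i t"
  shows "\<exists>Z. finite Z \<and> Z \<subseteq> open_segment s t \<and> (\<forall>z\<in>Z. U z L = 0) \<and>
    2 ^ (Suc n - i) - (if s = 0 then 1 else 0) \<le> card Z"
  using assms
proof (induction i arbitrary: s t rule: inc_induct)
  case base
  show ?case
  proof (cases "s = 0")
    case True
    then show ?thesis by (intro exI[of _ "{}"]) auto
  next
    case False
    have s: "U s L < 0" and t: "0 < U t L" using base False \<sigma>_end by (auto simp: low_def high_def)
    then obtain z where "z \<in> closed_segment s t" "U z L = 0"
      using ivt_closed_segment[OF U_continuous[of L], of s 0 t] L_pos by auto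
    with s t have "z \<in> open_segment s t" by (auto simp: open_segment_def)
    with \<open>U z L = 0\<close> show ?thesis by (intro exI[of _ "{z}"]) auto
  qed
next
  case (step i)
  then have i: "1 \<le> i" "i \<le> n" by auto
  obtain m where m: "m \<in> open_segment s t" "U m (\<tau> i) = C" "0 \<le> V m (\<tau> i)"
    using turning_slope[OF i step.prems(2,3)] .
  have hm: "high (Suc i) m" by (rule high_Suc[OF i]) (use m in auto)
  have "t \<noteq> 0"
    using step.prems(3) i U_zero[of "\<tau> i"] \<tau>_range[of i] by (auto simp: high_def)
  obtain Y where Y: "finite Y" "Y \<subseteq> open_segment s m" "\<forall>z\<in>Y. U z L = 0"
    "2 ^ (Suc n - Suc i) - (if s = 0 then 1 else 0) \<le> card Y"
    using step.IH[OF _ low_Suc[OF i step.prems(2)] hm] by auto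
  obtain Z where Z: "finite Z" "Z \<subseteq> open_segment t m" "\<forall>z\<in>Z. U z L = 0"
    "2 ^ (Suc n - Suc i) \<le> card Z"
    using step.IH[OF _ high_imp_low_Suc[OF i step.prems(3)] hm] \<open>t \<noteq> 0\<close> by auto
  have "open_segment s m \<inter> open_segment t m = {}"
    "open_segment s m \<union> open_segment t m \<subseteq> open_segment s t"
    using m(1) by (auto simp: open_segment_eq_real_ivl split: if_splits)
  with Y Z have "Y \<inter> Z = {}" "Y \<union> Z \<subseteq> open_segment s t" by blast+
  moreover have "card (Y \<union> Z) = card Y + card Z"
    using Y Z \<open>Y \<inter> Z = {}\<close> by (simp add: card_Un_disjoint)
  moreover have "(2::nat) ^ (Suc n - i) = 2 ^ (Suc n - Suc i) + 2 ^ (Suc n - Suc i)"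
    using i by (simp add: Suc_diff_le)
  ultimately show ?case using Y Z by (intro exI[of _ "Y \<union> Z"]) auto
qed

text \<open>The second derivative is at least \<open>- G\<close> as long as the solution is below \<open>R\<close>, so a solution with a
sufficiently large initial slope exceeds \<open>R\<close> before \<open>\<tau> 1\<close>.\<close>

lemma high_first_well: "\<exists>t>0. high 1 t"
proof -
  have \<tau>1: "0 < \<tau> 1" using well[of 1] \<sigma>_range[of 1] n_pos by auto
  have R: "0 < R" using C_pos C_le_R by simp
  \<comment> \<open>The slope for which the parabola with second derivative \<open>- G\<close> has height \<open>R\<close> at \<open>\<tau> 1\<close>.\<close>
  define t where "t = R / \<tau> 1 + G * \<tau> 1 / 2"
  have "0 < t" using R \<tau>1 G_nonneg by (simp add: t_def add_pos_nonneg)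
  have "\<exists>x\<in>{0..\<tau> 1}. R \<le> U t x"
  proof (rule ccontr)
    assume "\<not> ?thesis"
    then have less: "x \<in> {0..\<tau> 1} \<Longrightarrow> U t x < R" for x by force
    have "U t 0 + V t 0 * (\<tau> 1 - 0) + (- G) * (\<tau> 1 - 0)\<^sup>2 / 2 \<le> U t (\<tau> 1)"
    proof (rule quadratic_lower_bound[OF second_deriv_on_subset[OF U_ode]])
      fix x assume "x \<in> {0<..<\<tau> 1}"
      then show "- G \<le> F x (U t x)"
        using less[of x] \<tau>_range[of 1] n_pos by (intro F_lower) auto
    qed (use \<tau>1 \<tau>_range[of 1] n_pos in auto)
    moreover have "t * \<tau> 1 - G * (\<tau> 1)\<^sup>2 / 2 = R"
      using \<tau>1 by (simp add: t_def field_simps power2_eq_square)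
    ultimately show False using less[of "\<tau> 1"] \<tau>1 by (simp add: U_init)
  qed
  then obtain x where x: "x \<in> {0..\<tau> 1}" "R \<le> U t x" by blast
  have "\<exists>y\<in>{\<sigma> 1..\<tau> 1}. R \<le> U t y"
  proof (cases "\<sigma> 1 \<le> x")
    case False
    have "U t x \<le> U t (\<tau> 0) \<or> U t x \<le> U t (\<sigma> (Suc 0))"
      by (rule convex_max_at_ends[OF U_ode_gap[of 0] F_gap[of 0]]) (use x False \<tau>_0 in auto)
    then have "R \<le> U t (\<sigma> 1)" using x R \<tau>_0 U_init by auto
    then show ?thesis using well[of 1] n_pos by force
  qed (use x in auto)
  then obtain y where y: "y \<in> {\<sigma> 1..\<tau> 1}" "R \<le> U t y" by blast
  then have "U t (\<tau> 1) < 0" using U_well_bound[of 1 t y] n_pos by force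
  moreover have "C \<le> U t y" using y C_le_R by simp
  ultimately show ?thesis using y \<open>0 < t\<close> n_pos by (auto simp: high_def intro!: exI[of _ t])
qed

theorem many_shooting_slopes:
  "\<exists>Z. finite Z \<and> 2 ^ n - 1 \<le> card Z \<and> (\<forall>z\<in>Z. 0 < z \<and> U z L = 0)"
proof -
  obtain t where t: "0 < t" "high 1 t" using high_first_well by blast
  obtain Z where "finite Z" "Z \<subseteq> open_segment 0 t" "\<forall>z\<in>Z. U z L = 0" "2 ^ n - 1 \<le> card Z"
    using many_zeros_between[of 1 0 t] t by (auto simp: low_def)
  then show ?thesis using t by (intro exI[of _ Z]) (auto simp: open_segment_eq_real_ivl)
qed

text \<open>Confinement bounds the solution in the wells, convexity carries the bound across the gaps.\<close>

lemma U_bounds_if_zero_at_end: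
  assumes "U s L = 0" "x \<in> {0..L}"
  shows "0 \<le> U s x" and "U s x \<le> R"
proof -
  have nonneg: "0 \<le> U s y" if "y \<in> {0..L}" for y
    using U_nonneg_before[of s L y] assms(1) that by auto
  from nonneg[OF assms(2)] show "0 \<le> U s x" .
  have well_le: "U s y \<le> R" if "1 \<le> i" "i \<le> n" "y \<in> {\<sigma> i..\<tau> i}" for i y
    using U_well_bound[OF that(1,2) _ that(3), of s] nonneg[of "\<tau> i"] \<tau>_range[of i] that by auto
  from assms(2) show "U s x \<le> R"
  proof (cases rule: gap_or_well)
    case (in_well i)
    then show ?thesis by (rule well_le)
  next
    case (in_gap i)
    have "U s (\<tau> i) \<le> R"
      using well_le[of i "\<tau> i"] \<open>i \<le> n\<close> \<tau>_0 U_init C_pos C_le_R well[of i]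
      by (cases "i = 0") auto
    moreover have "U s (\<sigma> (Suc i)) \<le> R"
      using well_le[of "Suc i" "\<sigma> (Suc i)"] \<open>i \<le> n\<close> \<sigma>_end assms(1) C_pos C_le_R
        well[of "Suc i"]
      by (cases "i = n") auto
    moreover have "U s x \<le> U s (\<tau> i) \<or> U s x \<le> U s (\<sigma> (Suc i))"
      by (rule convex_max_at_ends[OF U_ode_gap[OF in_gap(1)] F_gap[OF in_gap(1)] in_gap(2)])
    ultimately show ?thesis by auto
  qed
qed

end

section \<open>The truncated nonlinearity\<close>

text \<open>The right-hand side of \<open>u'' = \<mu> u - a u\<^sup>p\<close>, written as \<open>(\<mu> - a u powr (p - 1)) u\<close> and modified twice. The
factor \<open>u powr (p - 1)\<close> is kept constant above the height \<open>R\<close>, which makes the equation globally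
Lipschitz while keeping it of superlinear type up to \<open>R\<close>; below zero everything is cut off, so that a
solution that crosses zero continues along a straight line.\<close>

definition truncated_rhs :: "real \<Rightarrow> real \<Rightarrow> (real \<Rightarrow> real) \<Rightarrow> real \<Rightarrow> real \<Rightarrow> real \<Rightarrow> real" where
  "truncated_rhs \<mu> p a R x y = (\<mu> - a x * min (max 0 y) R powr (p - 1)) * max 0 y"

lemma truncated_rhs_nonneg:
  assumes "0 \<le> \<mu>" "a x \<le> 0"
  shows "0 \<le> truncated_rhs \<mu> p a R x y"
proof -
  have "a x * min (max 0 y) R powr (p - 1) \<le> 0" using assms(2) by (rule mult_nonpos_nonneg) simp
  then show ?thesis using assms(1) unfolding truncated_rhs_def by (intro mult_nonneg_nonneg) auto
qed

lemma truncated_rhs_nonneg_small: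
  assumes "\<bar>a x\<bar> \<le> A" "1 < p" "0 < R" "A * C powr (p - 1) \<le> \<mu>" "y \<le> C" "0 < C"
  shows "0 \<le> truncated_rhs \<mu> p a R x y"
proof -
  have "a x * min (max 0 y) R powr (p - 1) \<le> A * C powr (p - 1)"
    using assms by (intro mult_mono powr_mono2) auto
  then show ?thesis using assms unfolding truncated_rhs_def by (intro mult_nonneg_nonneg) auto
qed

lemma truncated_rhs_lower:
  assumes "\<bar>a x\<bar> \<le> A" "1 < p" "0 < R" "0 \<le> \<mu>" "y \<le> R"
  shows "- (A * R powr (p - 1) * R) \<le> truncated_rhs \<mu> p a R x y"
proof -
  have "a x * min (max 0 y) R powr (p - 1) \<le> A * R powr (p - 1)"
    using assms by (intro mult_mono powr_mono2) auto
  then have "(- (A * R powr (p - 1))) * max 0 y \<le> truncated_rhs \<mu> p a R x y"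
    unfolding truncated_rhs_def using assms by (intro mult_right_mono) auto
  moreover have "A * R powr (p - 1) * max 0 y \<le> A * R powr (p - 1) * R"
    using assms by (intro mult_left_mono mult_nonneg_nonneg) auto
  ultimately show ?thesis by simp
qed

text \<open>Away from the truncation the derivative is \<open>(1 + q) y powr q\<close>. The product is split so that the mean value
theorem is needed for \<open>r powr q\<close> only, and there \<open>r powr (q - 1) * z \<le> r powr q\<close> since \<open>z\<close> is the smaller
argument; this covers exponents \<open>q < 1\<close>, for which \<open>r powr (q - 1)\<close> is unbounded.\<close>

lemma truncated_power_lipschitz:
  fixes q R :: real
  assumes "0 < q" "0 < R"
  shows "\<bar>min (max 0 y) R powr q * max 0 y - min (max 0 z) R powr q * max 0 z\<bar>
    \<le> (1 + q) * R powr q * \<bar>y - z\<bar>"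
proof -
  define g where "g y = min y R powr q * y" for y :: real
  have main: "\<bar>g y - g z\<bar> \<le> (1 + q) * R powr q * (y - z)" if "0 \<le> z" "z \<le> y" for y z
  proof -
    define s t where "s = min z R" and "t = min y R"
    have st: "0 \<le> s" "s \<le> t" "t \<le> R" "t \<le> y" "t - s \<le> y - z" "s \<le> z" "z = s \<or> t = s"
      using that \<open>0 < R\<close> by (auto simp: s_def t_def)
    have tR: "t powr q \<le> R powr q" using st \<open>0 < q\<close> by (intro powr_mono2) auto
    have "s powr q \<le> t powr q" using st \<open>0 < q\<close> by (intro powr_mono2) auto
    have mvt: "(t powr q - s powr q) * z \<le> q * R powr q * (y - z)"
    proof (cases "t = s \<or> z = 0")
      case True
      then show ?thesis using that \<open>0 < q\<close> by auto
    next
      case False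
      then have "0 < s" "s < t" "z = s" using st that by auto
      then obtain r where r: "s < r" "r < t" "t powr q - s powr q = (t - s) * (q * r powr (q - 1))"
        using MVT2[of s t "\<lambda>r. r powr q" "\<lambda>r. q * r powr (q - 1)"]
        by (force intro!: derivative_eq_intros)
      have "r powr (q - 1) * z \<le> r powr (q - 1) * r"
        using r \<open>z = s\<close> by (intro mult_left_mono) auto
      also have "\<dots> = r powr q" using r \<open>0 < s\<close> by (simp add: powr_diff)
      also have "\<dots> \<le> R powr q" using r \<open>0 < s\<close> st \<open>0 < q\<close> by (intro powr_mono2) auto
      finally have "(t - s) * q * (r powr (q - 1) * z) \<le> (y - z) * q * R powr q"
        using st \<open>0 < q\<close> \<open>s < t\<close> by (intro mult_mono) auto
      then show ?thesis unfolding r(3) by (simp add: mult_ac)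
    qed
    have "g y - g z = t powr q * (y - z) + (t powr q - s powr q) * z"
      by (simp add: g_def s_def t_def algebra_simps)
    moreover have "0 \<le> t powr q * (y - z)" "0 \<le> (t powr q - s powr q) * z"
      using that \<open>s powr q \<le> t powr q\<close> by auto
    moreover have "t powr q * (y - z) \<le> R powr q * (y - z)"
      using tR that by (intro mult_right_mono) auto
    ultimately show ?thesis using mvt by (simp add: algebra_simps)
  qed
  have "\<bar>g y - g z\<bar> \<le> (1 + q) * R powr q * \<bar>y - z\<bar>" if "0 \<le> y" "0 \<le> z" for y z
    using main[of z y] main[of y z] that by (cases "z \<le> y") (auto simp: abs_minus_commute)
  then have "\<bar>g (max 0 y) - g (max 0 z)\<bar> \<le> (1 + q) * R powr q * \<bar>max 0 y - max 0 z\<bar>"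
    by simp
  also have "\<dots> \<le> (1 + q) * R powr q * \<bar>y - z\<bar>"
    using \<open>0 < q\<close> by (intro mult_left_mono) auto
  finally show ?thesis by (simp add: g_def)
qed

lemma truncated_rhs_lipschitz:
  assumes "\<bar>a x\<bar> \<le> A" "1 < p" "0 < R" "0 \<le> \<mu>"
  shows "\<bar>truncated_rhs \<mu> p a R x y - truncated_rhs \<mu> p a R x z\<bar>
    \<le> (\<mu> + A * (p * R powr (p - 1))) * \<bar>y - z\<bar>"
proof -
  let ?g = "\<lambda>y. min (max 0 y) R powr (p - 1) * max 0 y"
  have "\<bar>truncated_rhs \<mu> p a R x y - truncated_rhs \<mu> p a R x z\<bar>
    = \<bar>\<mu> * (max 0 y - max 0 z) - a x * (?g y - ?g z)\<bar>"
    by (simp add: truncated_rhs_def algebra_simps)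
  also have "\<dots> \<le> \<mu> * \<bar>max 0 y - max 0 z\<bar> + \<bar>a x\<bar> * \<bar>?g y - ?g z\<bar>"
    using assms by (metis abs_mult abs_of_nonneg abs_triangle_ineq4)
  also have "\<dots> \<le> \<mu> * \<bar>y - z\<bar> + A * ((1 + (p - 1)) * R powr (p - 1) * \<bar>y - z\<bar>)"
    using assms by (intro add_mono mult_mono truncated_power_lipschitz) auto
  finally show ?thesis by (simp add: algebra_simps)
qed

lemma truncated_rhs_continuous:
  assumes "continuous_on S a" "1 < p" "0 < R" "continuous_on T g" "continuous_on T f" "g ` T \<subseteq> S"
  shows "continuous_on T (\<lambda>t. truncated_rhs \<mu> p a R (g t) (f t))"
proof -
  have "continuous_on T (\<lambda>t. a (g t))" using continuous_on_compose2[OF assms(1,4,6)] .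
  moreover have "continuous_on T (\<lambda>t. min (max 0 (f t)) R powr (p - 1))"
    using assms \<open>0 < R\<close>
    by (intro continuous_on_powr' continuous_on_min continuous_on_max continuous_on_const) auto
  ultimately show ?thesis
    unfolding truncated_rhs_def using assms(5)
    by (intro continuous_on_mult continuous_on_diff continuous_on_max continuous_on_const)
qed

text \<open>In the first half of a well the bound comes from a window \<open>[c, d]\<close> inside the second half, where the
weight is bounded below by a positive constant. It is a bound for all truncation heights that exceed it.\<close>

lemma nonneg_bound_first_half:
  fixes a :: "real \<Rightarrow> real"
  assumes "b < e" "continuous_on {b..e} a" "\<And>x. x \<in> {b<..<e} \<Longrightarrow> 0 < a x" "0 < \<mu>" "1 < p"
  obtains K where "\<And>R f f' x. K \<le> R \<Longrightarrow>
    second_deriv_on {b..e} f f' (\<lambda>x. truncated_rhs \<mu> p a R x (f x)) \<Longrightarrow>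
    (\<And>x. x \<in> {b..e} \<Longrightarrow> 0 \<le> f x) \<Longrightarrow> x \<in> {b..(b + e) / 2} \<Longrightarrow> f x < K"
proof -
  define c d k where "c = (b + e) / 2" and "d = (b + 3 * e) / 4" and "k = sqrt \<mu>"
  have cd: "b < c" "c < d" "d < e" using \<open>b < e\<close> by (auto simp: c_def d_def field_simps)
  have k: "0 < k" "k\<^sup>2 = \<mu>" using \<open>0 < \<mu>\<close> by (auto simp: k_def)
  obtain x0 where x0: "x0 \<in> {c..d}" "\<And>x. x \<in> {c..d} \<Longrightarrow> a x0 \<le> a x"
    using continuous_attains_inf[OF compact_Icc _ continuous_on_subset[OF assms(2)], of c d] cd by auto
  define m where "m = a x0"
  have m: "0 < m" "\<And>x. x \<in> {c..d} \<Longrightarrow> m \<le> a x"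
    using x0 assms(3)[of x0] cd by (auto simp: m_def)
  \<comment> \<open>Above height \<open>H\<close> the equation oscillates faster than the half-wave of \<open>[c, d]\<close>.\<close>
  define H where "H = (((pi / (d - c))\<^sup>2 + \<mu>) / m) powr (1 / (p - 1))"
  have base: "0 < (pi / (d - c))\<^sup>2 + \<mu>" using \<open>0 < \<mu>\<close> by (intro add_nonneg_pos) auto
  with m(1) have H: "0 < H" "m * H powr (p - 1) = (pi / (d - c))\<^sup>2 + \<mu>"
    using \<open>1 < p\<close> by (simp_all add: H_def powr_powr)
  define K where "K = H * (sinh (k * (e - b)) / sinh (k * (e - d)))"
  have sinh: "0 < sinh (k * (e - d))" "sinh (k * (e - d)) \<le> sinh (k * (e - b))" using k cd by auto
  have "H * 1 \<le> K" unfolding K_def using H sinh by (intro mult_left_mono) (auto simp: field_simps)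
  then have HK: "H \<le> K" by simp
  show thesis
  proof (rule that[of K])
    fix R f f' x
    assume R: "K \<le> R" and sd: "second_deriv_on {b..e} f f' (\<lambda>x. truncated_rhs \<mu> p a R x (f x))"
      and nonneg: "\<And>x. x \<in> {b..e} \<Longrightarrow> 0 \<le> f x" and x: "x \<in> {b..(b + e) / 2}"
    have xc: "x \<le> c" "b \<le> x" using x by (auto simp: c_def)
    have "f x * sinh (k * (e - d)) < H * sinh (k * (e - x))"
    proof (rule nonneg_solution_bound[OF second_deriv_on_subset[OF sd] k(1) H(1) xc(1) cd(2,3)])
      fix y assume y: "y \<in> {x<..<e}"
      then have "0 \<le> a y" "0 \<le> f y" using assms(3)[of y] nonneg[of y] xc by auto
      then have "(\<mu> - a y * min (max 0 (f y)) R powr (p - 1)) * f y \<le> \<mu> * f y"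
        by (intro mult_right_mono) auto
      then show "truncated_rhs \<mu> p a R y (f y) \<le> k\<^sup>2 * f y"
        using k \<open>0 \<le> f y\<close> by (simp add: truncated_rhs_def)
    next
      fix y assume y: "y \<in> {c..d}" "H \<le> f y"
      have "m * H powr (p - 1) \<le> a y * min (max 0 (f y)) R powr (p - 1)"
        using m(1) m(2)[of y] y H HK R \<open>1 < p\<close> by (intro mult_mono powr_mono2) auto
      then have "(\<mu> - a y * min (max 0 (f y)) R powr (p - 1)) * f y \<le> - (pi / (d - c))\<^sup>2 * f y"
        using H y by (intro mult_right_mono) auto
      then show "truncated_rhs \<mu> p a R y (f y) \<le> - (pi / (d - c))\<^sup>2 * f y"
        using H y by (simp add: truncated_rhs_def)
    qed (use nonneg xc cd in auto)
    also have "\<dots> \<le> H * sinh (k * (e - b))" using H k xc by (intro mult_left_mono) auto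
    finally show "f x < K" unfolding K_def using sinh by (simp add: field_simps)
  qed
qed

text \<open>The second half of the well is the first half of its mirror image.\<close>

lemma nonneg_bound:
  fixes a :: "real \<Rightarrow> real"
  assumes "b < e" "continuous_on {b..e} a" "\<And>x. x \<in> {b<..<e} \<Longrightarrow> 0 < a x" "0 < \<mu>" "1 < p"
  shows "\<exists>K. \<forall>R f f'. K \<le> R \<longrightarrow>
    second_deriv_on {b..e} f f' (\<lambda>x. truncated_rhs \<mu> p a R x (f x)) \<longrightarrow>
    (\<forall>x\<in>{b..e}. 0 \<le> f x) \<longrightarrow> (\<forall>x\<in>{b..e}. f x < R)"
proof -
  obtain K1 where K1: "\<And>R f f' x. K1 \<le> R \<Longrightarrow>
    second_deriv_on {b..e} f f' (\<lambda>x. truncated_rhs \<mu> p a R x (f x)) \<Longrightarrow>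
    (\<And>x. x \<in> {b..e} \<Longrightarrow> 0 \<le> f x) \<Longrightarrow> x \<in> {b..(b + e) / 2} \<Longrightarrow> f x < K1"
    using nonneg_bound_first_half[OF assms] by blast
  have "continuous_on {-e..-b} (\<lambda>x. a (-x))"
    by (rule continuous_on_compose2[OF assms(2)]) (auto intro!: continuous_intros)
  then obtain K2 where K2: "\<And>R f f' x. K2 \<le> R \<Longrightarrow>
    second_deriv_on {-e..-b} f f' (\<lambda>x. truncated_rhs \<mu> p (\<lambda>x. a (-x)) R x (f x)) \<Longrightarrow>
    (\<And>x. x \<in> {-e..-b} \<Longrightarrow> 0 \<le> f x) \<Longrightarrow> x \<in> {-e..(-e + -b) / 2} \<Longrightarrow> f x < K2"
    using nonneg_bound_first_half[of "-e" "-b" "\<lambda>x. a (-x)" \<mu> p] assms by auto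
  show ?thesis
  proof (intro exI[of _ "max K1 K2"] allI impI ballI)
    fix R f f' x
    assume R: "max K1 K2 \<le> R"
      and sd: "second_deriv_on {b..e} f f' (\<lambda>x. truncated_rhs \<mu> p a R x (f x))"
      and nonneg: "\<forall>x\<in>{b..e}. 0 \<le> f x" and x: "x \<in> {b..e}"
    show "f x < R"
    proof (cases "x \<le> (b + e) / 2")
      case True
      then show ?thesis using K1[OF _ sd, of x] R nonneg x by auto
    next
      case False
      have "second_deriv_on {-e..-b} (\<lambda>x. f (-x)) (\<lambda>x. - f' (-x))
        (\<lambda>x. truncated_rhs \<mu> p (\<lambda>x. a (-x)) R x (f (-x)))"
        using second_deriv_on_reflect[OF sd] by (simp add: truncated_rhs_def)
      from K2[OF _ this, of "-x"] show ?thesis using False R nonneg x by auto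
    qed
  qed
qed

text \<open>The middle third of the gap, where the weight is bounded away from zero, suffices for the blow-up. The
linear term \<open>\<mu> f\<close> only helps, so the threshold \<open>C\<close> is the same for all \<open>\<mu> \<ge> 0\<close>.\<close>

lemma growth_threshold:
  fixes a :: "real \<Rightarrow> real"
  assumes "b < e" "continuous_on {b..e} a" "\<And>x. x \<in> {b<..<e} \<Longrightarrow> a x < 0" "1 < p"
  shows "\<exists>C>0. \<forall>\<mu> R f f'. 0 \<le> \<mu> \<longrightarrow> 0 < R \<longrightarrow>
    second_deriv_on {b..e} f f' (\<lambda>x. truncated_rhs \<mu> p a R x (f x)) \<longrightarrow>
    C \<le> f b \<longrightarrow> 0 \<le> f' b \<longrightarrow> R \<le> f e"
proof -
  define c d q where "c = b + (e - b) / 3" and "d = b + 2 * (e - b) / 3" and "q = (p - 1) / 2"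
  have cd: "b < c" "c < d" "d < e" using \<open>b < e\<close> by (auto simp: c_def d_def field_simps)
  have q: "0 < q" "2 * q = p - 1" using \<open>1 < p\<close> by (auto simp: q_def)
  obtain x0 where x0: "x0 \<in> {c..d}" "\<And>x. x \<in> {c..d} \<Longrightarrow> a x \<le> a x0"
    using continuous_attains_sup[OF compact_Icc _ continuous_on_subset[OF assms(2)], of c d] cd by auto
  define m where "m = - a x0"
  have m: "0 < m" "\<And>x. x \<in> {c..d} \<Longrightarrow> m \<le> - a x"
    using x0 assms(3)[of x0] cd by (auto simp: m_def)
  define l where "l = (d - c) * (1 - 2 powr (- q))"
  have "(2::real) powr (- q) < 1" using q by (simp add: powr_less_one)
  then have l: "0 < l" using cd by (simp add: l_def)
  define C where "C = (2 / (m * l\<^sup>2)) powr (1 / (2 * q))"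
  have "0 < 2 / (m * l\<^sup>2)" using m l by simp
  then have C: "0 < C" "m * C powr (2 * q) * l\<^sup>2 = 2"
    using q(1) m l by (auto simp: C_def powr_powr)
  show ?thesis
  proof (intro exI[of _ C] conjI allI impI C)
    fix \<mu> R f f'
    assume \<mu>: "0 \<le> \<mu>" and R: "0 < R" and start: "C \<le> f b" "0 \<le> f' b"
      and sd: "second_deriv_on {b..e} f f' (\<lambda>x. truncated_rhs \<mu> p a R x (f x))"
    have conv: "0 \<le> truncated_rhs \<mu> p a R x (f x)" if "x \<in> {b<..<e}" for x
      using assms(3)[OF that] \<mu> by (intro truncated_rhs_nonneg) auto
    have "R \<le> f d"
    proof (rule superlinear_growth_reaches[OF second_deriv_on_subset[OF sd] cd(2) q(1) C(1)])
      fix x assume x: "x \<in> {c..d}" "C \<le> f x"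
      have "m * min (f x) R powr (2 * q) \<le> - a x * min (f x) R powr (2 * q)"
        using m(2)[OF x(1)] by (intro mult_right_mono) auto
      also have "\<dots> \<le> \<mu> - a x * min (max 0 (f x)) R powr (p - 1)"
        using \<mu> x C q by (simp add: max_def)
      finally have "m * min (f x) R powr (2 * q) * f x
          \<le> (\<mu> - a x * min (max 0 (f x)) R powr (p - 1)) * f x"
        using x C by (intro mult_right_mono) auto
      then show "m * min (f x) R powr (2 * q) * f x \<le> truncated_rhs \<mu> p a R x (f x)"
        using x C by (simp add: truncated_rhs_def max_def)
    next
      show "2 \<le> m * C powr (2 * q) * ((d - c) * (1 - 2 powr (- q)))\<^sup>2"
        using C(2) by (simp add: l_def)
      show "C \<le> f c"
        using nonneg_slope_mono[OF sd conv start(2), of b c] start cd by auto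
      show "0 \<le> f' c"
        using slope_mono[OF sd conv, of b c] start cd by auto
      show "x \<in> {c..d} \<Longrightarrow> 0 \<le> truncated_rhs \<mu> p a R x (f x)" for x
        using conv[of x] cd by auto
    qed (use m cd in auto)
    also have "\<dots> \<le> f e"
      using nonneg_slope_mono[OF sd conv start(2), of d e] cd by auto
    finally show "R \<le> f e" .
  qed
qed

lemma growth_threshold_two_sided:
  fixes a :: "real \<Rightarrow> real"
  assumes "b < e" "continuous_on {b..e} a" "\<And>x. x \<in> {b<..<e} \<Longrightarrow> a x < 0" "1 < p"
  shows "\<exists>C>0. \<forall>\<mu> R f f'. 0 \<le> \<mu> \<longrightarrow> 0 < R \<longrightarrow>
    second_deriv_on {b..e} f f' (\<lambda>x. truncated_rhs \<mu> p a R x (f x)) \<longrightarrow>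
    (C \<le> f b \<longrightarrow> 0 \<le> f' b \<longrightarrow> R \<le> f e) \<and> (C \<le> f e \<longrightarrow> f' e \<le> 0 \<longrightarrow> R \<le> f b)"
proof -
  obtain C1 where C1: "0 < C1" "\<And>\<mu> R f f'. 0 \<le> \<mu> \<Longrightarrow> 0 < R \<Longrightarrow>
    second_deriv_on {b..e} f f' (\<lambda>x. truncated_rhs \<mu> p a R x (f x)) \<Longrightarrow>
    C1 \<le> f b \<Longrightarrow> 0 \<le> f' b \<Longrightarrow> R \<le> f e"
    using growth_threshold[OF assms] by metis
  have "continuous_on {-e..-b} (\<lambda>x. a (-x))"
    by (rule continuous_on_compose2[OF assms(2)]) (auto intro!: continuous_intros)
  then have "\<exists>C>0. \<forall>\<mu> R f f'. 0 \<le> \<mu> \<longrightarrow> 0 < R \<longrightarrow>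
    second_deriv_on {-e..-b} f f' (\<lambda>x. truncated_rhs \<mu> p (\<lambda>x. a (-x)) R x (f x)) \<longrightarrow>
    C \<le> f (-e) \<longrightarrow> 0 \<le> f' (-e) \<longrightarrow> R \<le> f (-b)"
    using assms by (intro growth_threshold) auto
  then obtain C2 where C2: "0 < C2" "\<And>\<mu> R f f'. 0 \<le> \<mu> \<Longrightarrow> 0 < R \<Longrightarrow>
    second_deriv_on {-e..-b} f f' (\<lambda>x. truncated_rhs \<mu> p (\<lambda>x. a (-x)) R x (f x)) \<Longrightarrow>
    C2 \<le> f (-e) \<Longrightarrow> 0 \<le> f' (-e) \<Longrightarrow> R \<le> f (-b)"
    by metis
  show ?thesis
  proof (intro exI[of _ "max C1 C2"] conjI allI impI)
    fix \<mu> R f f'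
    assume *: "0 \<le> \<mu>" "0 < R"
      and sd: "second_deriv_on {b..e} f f' (\<lambda>x. truncated_rhs \<mu> p a R x (f x))"
    show "R \<le> f e" if "max C1 C2 \<le> f b" "0 \<le> f' b"
      using C1(2)[OF * sd] that by simp
    have "second_deriv_on {-e..-b} (\<lambda>x. f (-x)) (\<lambda>x. - f' (-x))
        (\<lambda>x. truncated_rhs \<mu> p (\<lambda>x. a (-x)) R x (f (-x)))"
      using second_deriv_on_reflect[OF sd] by (simp add: truncated_rhs_def)
    from C2(2)[OF * this] show "R \<le> f b" if "max C1 C2 \<le> f e" "f' e \<le> 0"
      using that by simp
  qed (use C1 in simp)
qed

section \<open>Positive solutions of the boundary value problem\<close>

lemma finite_upper_bound:
  fixes h :: "'a \<Rightarrow> real"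
  assumes "finite I"
  obtains M where "M0 \<le> M" "\<And>i. i \<in> I \<Longrightarrow> h i \<le> M"
  using assms by (intro that[of "Max (insert M0 (h ` I))"]) auto

text \<open>A solution of the truncated problem with values in \<open>[0, R]\<close> never feels the truncation.\<close>

lemma positive_solution_restrict:
  assumes "0 < L" "1 < p" "continuous_on {0..L} a" "0 < R"
    and sd: "second_deriv_on {0..L} u v (\<lambda>x. truncated_rhs \<mu> p a R x (u x))"
    and bc: "u 0 = 0" "u L = 0" and slope: "v 0 \<noteq> 0"
    and range: "\<And>x. x \<in> {0..L} \<Longrightarrow> 0 \<le> u x \<and> u x \<le> R"
  shows "positive_solution L p a (- \<mu>) (restrict u {0..L})"
proof -
  let ?w = "restrict u {0..L}" and ?F = "\<lambda>x. truncated_rhs \<mu> p a R x (u x)"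
  have u': "(u has_real_derivative v x) (at x within {0..L})"
    and v': "(v has_real_derivative ?F x) (at x within {0..L})" if "x \<in> {0..L}" for x
    using sd that by (auto simp: second_deriv_on_def)
  have w': "(?w has_real_derivative v x) (at x within {0..L})" if "x \<in> {0..L}" for x
    using u'[OF that] that unfolding has_field_derivative_def
    by (rule has_derivative_transform[rotated 2]) auto
  have "continuous_on {0..L} ?F"
    using assms by (intro truncated_rhs_continuous[OF assms(3)] second_deriv_on_continuous[OF sd])
      (auto intro: continuous_on_id)
  with w' v' have C2: "C2_on {0..L} ?w"
    unfolding C2_on_def by (intro exI[of _ v] exI[of _ ?F] conjI ballI)
  have ode: "- deriv (deriv ?w) x = - \<mu> * ?w x + a x * ?w x powr p" if x: "x \<in> {0<..<L}" for x
  proof -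
    have d1: "deriv ?w y = v y" if "y \<in> {0<..<L}" for y
      using w'[of y] that by (intro DERIV_imp_deriv) (simp add: at_within_Icc_at)
    have "\<forall>\<^sub>F y in nhds x. deriv ?w y = v y"
      using d1 eventually_nhds_in_open[OF open_greaterThanLessThan x] by (rule eventually_mono[rotated])
    then have "deriv (deriv ?w) x = deriv v x" by (intro deriv_cong_ev refl)
    also have "\<dots> = ?F x"
      using v'[of x] x by (intro DERIV_imp_deriv) (simp add: at_within_Icc_at)
    also have "\<dots> = \<mu> * u x - a x * (u x powr (p - 1) * u x)"
      using range[of x] x by (simp add: truncated_rhs_def algebra_simps)
    also have "u x powr (p - 1) * u x = u x powr p"
      using range[of x] x by (cases "u x = 0") (auto simp: powr_diff)
    finally have "deriv (deriv ?w) x = \<mu> * u x - a x * u x powr p" .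
    moreover have "?w x = u x" using x by simp
    ultimately show ?thesis by (simp only:)
  qed
  have nz: "\<exists>x\<in>{0..L}. ?w x \<noteq> 0"
  proof (rule ccontr)
    assume "\<not> ?thesis"
    then have "x \<in> {0..L} \<Longrightarrow> u x = 0" for x by auto
    moreover have "((\<lambda>x. 0::real) has_real_derivative 0) (at 0 within {0..L})" by simp
    ultimately have "(u has_real_derivative 0) (at 0 within {0..L})"
      unfolding has_field_derivative_def using \<open>0 < L\<close>
      by (intro has_derivative_transform[of 0 "{0..L}" u "\<lambda>_. 0"]) auto
    then have "v 0 = 0"
      using vector_derivative_unique_within_closed_interval[of 0 L 0 u "v 0" 0] u'[of 0] \<open>0 < L\<close>
      by (auto simp: has_real_derivative_iff_has_vector_derivative)
    with slope show False by simp
  qed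
  show ?thesis
    unfolding positive_solution_def using C2 ode nz range bc \<open>0 < L\<close> by auto
qed

theorem theorem1p1:
  fixes L p :: real and a :: "real \<Rightarrow> real"
    and n :: nat and \<sigma> \<tau> :: "nat \<Rightarrow> real"
  assumes "L > 0" and "p > 1" and "continuous_on {0..L} a"
    and "n \<ge> 1"
    and "\<tau> 0 = 0" and "\<tau> 0 \<le> \<sigma> 1"
    and "\<And>i. i \<in> {1..n} \<Longrightarrow> \<sigma> i < \<tau> i"
    and "\<And>i. i \<in> {1..<n} \<Longrightarrow> \<tau> i < \<sigma> (i + 1)"
    and "\<tau> n \<le> \<sigma> (n + 1)" and "\<sigma> (n + 1) = L"
    and "\<And>i x. i \<in> {1..n} \<Longrightarrow> x \<in> {\<sigma> i<..<\<tau> i} \<Longrightarrow> a x > 0"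
    and "\<And>i x. i \<in> {0..n} \<Longrightarrow> x \<in> {\<tau> i<..<\<sigma> (i + 1)} \<Longrightarrow> a x < 0"
    and "\<And>i. i \<in> {1..n} \<Longrightarrow>
          \<exists>\<gamma> \<rho>. \<gamma> > 0 \<and> continuous_on {\<sigma> i..\<tau> i} \<rho> \<and>
            (\<exists>U m. open U \<and> {\<sigma> i, \<tau> i} \<subseteq> U \<and> m > 0 \<and>
                   (\<forall>x\<in>U \<inter> {\<sigma> i..\<tau> i}. m \<le> \<bar>\<rho> x\<bar>)) \<and>
            (\<forall>x\<in>{\<sigma> i<..<\<tau> i}. a x = \<rho> x * infdist x {\<sigma> i, \<tau> i} powr \<gamma>)"
  shows "\<exists>lam_c<0. \<forall>lam<lam_c. \<exists>S.
           S \<subseteq> {u \<in> extensional {0..L}. positive_solution L p a lam u} \<and>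
           finite S \<and> card S \<ge> 2 ^ n - 1"
proof -
  have gap: "\<tau> i \<le> \<sigma> (Suc i)" if "i \<le> n" for i
    using assms(6,8,9) that by (cases "i = 0"; cases "i = n") (force simp: less_imp_le)+
  have well: "\<sigma> i < \<tau> i" if "1 \<le> i" "i \<le> n" for i using assms(7) that by auto
  interpret well_geometry L n \<sigma> \<tau>
    by standard (use assms(4,5,10) well gap in auto)
  have a_well: "continuous_on {\<sigma> i..\<tau> i} a" if "1 \<le> i" "i \<le> n" for i
    using well_subset[OF that] by (rule continuous_on_subset[OF assms(3)])
  have a_gap: "continuous_on {\<tau> i..\<sigma> (Suc i)} a" if "i \<le> n" for i
    using gap_subset[OF that] by (rule continuous_on_subset[OF assms(3)])
  have "bounded (a ` {0..L})"
    by (intro compact_imp_bounded compact_continuous_image assms(3) compact_Icc)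
  then obtain A where "\<forall>y\<in>a ` {0..L}. norm y \<le> A" by (auto simp only: bounded_iff)
  then have A: "\<bar>a x\<bar> \<le> A" if "x \<in> {0..L}" for x using that by auto
  have "0 \<le> A" using A[of 0] \<open>L > 0\<close> by simp
  define grows where "grows i C \<longleftrightarrow> (\<forall>\<mu> R f f'. 0 \<le> \<mu> \<longrightarrow> 0 < R \<longrightarrow>
    second_deriv_on {\<tau> i..\<sigma> (Suc i)} f f' (\<lambda>x. truncated_rhs \<mu> p a R x (f x)) \<longrightarrow>
    (C \<le> f (\<tau> i) \<longrightarrow> 0 \<le> f' (\<tau> i) \<longrightarrow> R \<le> f (\<sigma> (Suc i))) \<and>
    (C \<le> f (\<sigma> (Suc i)) \<longrightarrow> f' (\<sigma> (Suc i)) \<le> 0 \<longrightarrow> R \<le> f (\<tau> i)))" for i C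
  have "\<exists>C>0. grows i C" if "i \<in> {1..<n}" for i
    unfolding grows_def
    using assms(8,12)[of i] that a_gap[of i] \<open>p > 1\<close> by (intro growth_threshold_two_sided) auto
  then obtain c where c: "\<And>i. i \<in> {1..<n} \<Longrightarrow> grows i (c i)" by metis
  obtain C where C: "1 \<le> C" "\<And>i. i \<in> {1..<n} \<Longrightarrow> c i \<le> C"
    using finite_upper_bound[of "{1..<n}" 1 c] by auto
  \<comment> \<open>Beyond this value \<open>a x * u powr (p - 1) \<le> - lam\<close> for \<open>0 \<le> u \<le> C\<close>: solutions are convex below \<open>C\<close>.
    That \<open>C\<close> was found before \<open>lam\<close> is essential here.\<close>
  define lam_c where "lam_c = - (A * C powr (p - 1) + 1)"
  show ?thesis
  proof (intro exI[of _ lam_c] conjI allI impI)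
    have "0 \<le> A * C powr (p - 1)" using \<open>0 \<le> A\<close> by simp
    then show "lam_c < 0" by (simp add: lam_c_def)
    fix lam assume lam: "lam < lam_c"
    define \<mu> where "\<mu> = - lam"
    have \<mu>: "0 < \<mu>" "A * C powr (p - 1) \<le> \<mu>"
      using lam \<open>0 \<le> A * C powr (p - 1)\<close> by (auto simp: \<mu>_def lam_c_def)
    define confines where "confines i K \<longleftrightarrow> (\<forall>R f f'. K \<le> R \<longrightarrow>
      second_deriv_on {\<sigma> i..\<tau> i} f f' (\<lambda>x. truncated_rhs \<mu> p a R x (f x)) \<longrightarrow>
      (\<forall>x\<in>{\<sigma> i..\<tau> i}. 0 \<le> f x) \<longrightarrow> (\<forall>x\<in>{\<sigma> i..\<tau> i}. f x < R))" for i K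
    have "\<exists>K. confines i K" if "i \<in> {1..n}" for i
      unfolding confines_def
      using well[of i] a_well[of i] assms(11)[of i] that \<mu> \<open>p > 1\<close> by (intro nonneg_bound) auto
    then obtain k where k: "\<And>i. i \<in> {1..n} \<Longrightarrow> confines i (k i)" by metis
    obtain R where R: "C \<le> R" "\<And>i. i \<in> {1..n} \<Longrightarrow> k i \<le> R"
      using finite_upper_bound[of "{1..n}" C k] by auto
    then have "0 < R" using C by simp
    define F where "F = truncated_rhs \<mu> p a R"
    have F_cont: "continuous_on ({0..L} \<times> UNIV) (\<lambda>(x, y). F x y)"
      unfolding F_def case_prod_beta
      by (rule truncated_rhs_continuous[OF assms(3)])
        (use \<open>p > 1\<close> \<open>0 < R\<close> in \<open>auto intro!: continuous_intros\<close>)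
    have F_lip: "\<bar>F x y - F x z\<bar> \<le> (\<mu> + A * (p * R powr (p - 1))) * \<bar>y - z\<bar>"
      if "x \<in> {0..L}" for x y z
      unfolding F_def using A[OF that] \<open>p > 1\<close> \<open>0 < R\<close> \<mu> by (intro truncated_rhs_lipschitz) auto
    obtain U V B where U: "\<And>s. second_deriv_on {0..L} (U s) (V s) (\<lambda>x. F x (U s x))"
      "\<And>s. U s 0 = 0" "\<And>s. V s 0 = s" "\<And>x. x \<in> {0..L} \<Longrightarrow> U 0 x = 0"
      "\<And>s t x. x \<in> {0..L} \<Longrightarrow> \<bar>U s x - U t x\<bar> \<le> B * \<bar>s - t\<bar>"
      by (rule shooting_family[OF \<open>L > 0\<close> F_cont F_lip]) (auto simp: F_def truncated_rhs_def)
    interpret well_chain L n \<sigma> \<tau> R C "A * R powr (p - 1) * R" B F U V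
    proof
      show "0 \<le> F x y" if "i \<le> n" "x \<in> {\<tau> i<..<\<sigma> (Suc i)}" for i x y
        unfolding F_def using assms(12)[of i x] that \<mu> by (intro truncated_rhs_nonneg) auto
      show "0 \<le> F x y" if "x \<in> {0..L}" "y \<le> C" for x y
        unfolding F_def using A[OF that(1)] \<mu> \<open>p > 1\<close> \<open>0 < R\<close> C that
        by (intro truncated_rhs_nonneg_small[of a x A p R C]) auto
      show "- (A * R powr (p - 1) * R) \<le> F x y" if "x \<in> {0..L}" "y \<le> R" for x y
        unfolding F_def using A[OF that(1)] \<mu> \<open>p > 1\<close> \<open>0 < R\<close> that
        by (intro truncated_rhs_lower) auto
      show "f x < R" if "1 \<le> i" "i \<le> n" "second_deriv_on {\<sigma> i..\<tau> i} f f' (\<lambda>x. F x (f x))"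
        "\<And>x. x \<in> {\<sigma> i..\<tau> i} \<Longrightarrow> 0 \<le> f x" "x \<in> {\<sigma> i..\<tau> i}" for i f f' x
        using k[of i, unfolded confines_def, rule_format, of R f f' x] R(2)[of i] that
        by (simp add: F_def)
      show "R \<le> f (\<sigma> (Suc i))" if "1 \<le> i" "i < n" "C \<le> f (\<tau> i)" "0 \<le> f' (\<tau> i)"
        "second_deriv_on {\<tau> i..\<sigma> (Suc i)} f f' (\<lambda>x. F x (f x))" for i f f'
        using c[of i, unfolded grows_def, rule_format, THEN conjunct1, of \<mu> R f f'] C(2)[of i]
          that \<mu> \<open>0 < R\<close> by (simp add: F_def)
      show "R \<le> f (\<tau> i)" if "1 \<le> i" "i < n" "C \<le> f (\<sigma> (Suc i))" "f' (\<sigma> (Suc i)) \<le> 0"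
        "second_deriv_on {\<tau> i..\<sigma> (Suc i)} f f' (\<lambda>x. F x (f x))" for i f f'
        using c[of i, unfolded grows_def, rule_format, THEN conjunct2, of \<mu> R f f'] C(2)[of i]
          that \<mu> \<open>0 < R\<close> by (simp add: F_def)
    qed (use C R \<open>0 < R\<close> \<open>0 \<le> A\<close> U in \<open>auto simp: F_def truncated_rhs_def\<close>)
    obtain Z where Z: "finite Z" "2 ^ n - 1 \<le> card Z" "\<And>z. z \<in> Z \<Longrightarrow> 0 < z \<and> U z L = 0"
      using many_shooting_slopes by blast
    define sol where "sol z = restrict (U z) {0..L}" for z
    have "positive_solution L p a lam (sol z)" if "z \<in> Z" for z
      using positive_solution_restrict[of L p a R "U z" "V z" \<mu>] U(1)[of z] U_init Z(3)[OF that]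
        U_bounds_if_zero_at_end[of z] \<open>L > 0\<close> \<open>p > 1\<close> \<open>0 < R\<close> assms(3)
      by (auto simp: sol_def F_def \<mu>_def)
    \<comment> \<open>A solution determines its slope at \<open>0\<close>.\<close>
    moreover have "inj_on sol Z"
    proof (rule inj_onI)
      fix y z assume "sol y = sol z"
      then have eq: "U y x = U z x" if "x \<in> {0..L}" for x
        using that unfolding sol_def by (metis restrict_apply')
      have d: "(U s has_real_derivative s) (at 0 within {0..L})" for s
        using U(1)[of s] U(3)[of s] \<open>L > 0\<close> by (force simp: second_deriv_on_def)
      have "(U z has_real_derivative y) (at 0 within {0..L})"
        using d[of y] unfolding has_field_derivative_def
        by (rule has_derivative_transform[rotated 2]) (use eq \<open>L > 0\<close> in auto)
      with d[of z] show "y = z"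
        using vector_derivative_unique_within_closed_interval[of 0 L 0 "U z" y z] \<open>L > 0\<close>
        by (auto simp: has_real_derivative_iff_has_vector_derivative)
    qed
    ultimately show "\<exists>S. S \<subseteq> {u \<in> extensional {0..L}. positive_solution L p a lam u} \<and>
           finite S \<and> card S \<ge> 2 ^ n - 1"
      using Z(1,2) by (intro exI[of _ "sol ` Z"]) (auto simp: card_image, simp add: sol_def)
  qed
qed

end
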